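(* Let $k$ be a positive integer and let $G=(I,(S_i)_{i\in I},X,P,(g_i)_{i\in I},(\gamma_i)_{i\in I})$ be a $k$-step mixed strategy stochastic game with $|I|<\infty$ and $|X|<\infty$, and suppose that each $S_i$ is a finite set. Then for any initial stationary (i.e. time-independent $k$-step) joint mixed strategy $\sigma$ there exists a finite-length satisficing path $(\sigma^t)_{t=0}^{T}$ of $k$-step joint mixed strategies such that $\sigma^0=\sigma$ and $\sigma^T$ is a mixed equilibrium of $G$.
   Context: In a $k$-step mixed strategy stochastic game $G=(I,(S_i)_{i\in I},X,P,(g_i)_{i\in I},(\gamma_i)_{i\in I})$: $I$ is the finite set of players; $S_i$ is the strategy (action) set of player $i$; $X$ is the finite state set; $P:X\times\prod_{i\in I}S_i\to\Delta X$ is the transition probability function; $g_i:X\times\prod_{j\in I}S_j\to\mathbb{R}$ is the payoff function of player $i$; $\gamma_i\in[0,1)$ is the discount factor of player $i$. For a finite set $Y$, $\Delta Y$ is the set of probability distributions on $Y$. A ($k$-step) mixed strategy of player $i$ is a map $\pi_i:X\times(\prod_{j\in I}S_j)^k\to\Delta S_i$; it does not depend on time. A joint mixed strategy is $\pi=(\pi_i)_{i\in I}$. When the current state is $x$ and the joint action profile $t$ steps before the current time is $s^{-t}$ ($t=1,\dots,k$), player $i$ draws an action from $\pi_i(x,s^{-1},\dots,s^{-k})$, independently of the other players. Given an initial state $x$ and initial history $h=(s^{-1},\dots,s^{-k})\in(\prod_{j\in I}S_j)^k$, play proceeds as follows: $x^0=x$; at each time $t\ge 0$, a joint action $s^t$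 is drawn in this way from the current state $x^t$ and the $k$ most recent joint actions, player $i$ receives $g_i(x^t,s^t)$, and $x^{t+1}\sim P(x^t,s^t)$. The value of player $i$ is $$V_i^{\pi}(x,h)=\mathbb{E}_{\pi}\Big[\sum_{t\ge0}\gamma_i^t g_i(x^t,s^t)\,\Big|\,x^0=x,\ \text{initial history }h\Big].$$ Player $i$ achieves best response in $\pi=(\pi_i,\pi_{-i})$ if for every initial pair $(x,h)$, $V_i^{\pi}(x,h)=\sup_{\sigma_i}V_i^{(\sigma_i,\pi_{-i})}(x,h)$, the supremum being over all $k$-step mixed strategies $\sigma_i$ of player $i$. A mixed equilibrium is a joint mixed strategy in which every player achieves best response. A satisficing path $(\sigma^t)_{t=0}^T$ is a sequence of $k$-step joint mixed strategies such that for every $0\le t<T$ and every $i\in I$: if player $i$ achieves best response in $\sigma^t$, then $\sigma_i^{t+1}=\sigma_i^t$. *)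

theory Defs
  imports "HOL-Probability.Probability"
begin

section \<open>Games and strategies\<close>

record ('i, 's, 'x) game =
  players :: "'i set"
  actions :: "'i \<Rightarrow> 's set"
  states :: "'x set"
  trans :: "'x \<Rightarrow> ('i \<Rightarrow> 's) \<Rightarrow> 'x pmf"
  payoff :: "'i \<Rightarrow> 'x \<Rightarrow> ('i \<Rightarrow> 's) \<Rightarrow> real"
  discount :: "'i \<Rightarrow> real"

definition profiles :: "('i, 's, 'x) game \<Rightarrow> ('i \<Rightarrow> 's) set" where
  "profiles G = PiE (players G) (actions G)"

definition stochastic_game :: "('i, 's, 'x) game \<Rightarrow> bool" where
  "stochastic_game G \<longleftrightarrow>
     finite (players G) \<and> finite (states G) \<and>
     (\<forall>x\<in>states G. \<forall>s\<in>profiles G. set_pmf (trans G x s) \<subseteq> states G) \<and>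
     (\<forall>i\<in>players G. 0 \<le> discount G i \<and> discount G i < 1)"

text \<open>Histories are listed with the most recent joint action first.\<close>

definition histories :: "nat \<Rightarrow> ('i, 's, 'x) game \<Rightarrow> ('i \<Rightarrow> 's) list set" where
  "histories k G = {h. length h = k \<and> set h \<subseteq> profiles G}"

type_synonym ('i, 's, 'x) strategy = "'x \<times> ('i \<Rightarrow> 's) list \<Rightarrow> 's pmf"

text \<open>
  Strategies are extensional, so HOL equality of two strategies is equality of
  maps with domain the (state, history) pairs of the game.
\<close>

definition mixed_strategies ::
  "nat \<Rightarrow> ('i, 's, 'x) game \<Rightarrow> 'i \<Rightarrow> ('i, 's, 'x) strategy set" where
  "mixed_strategies k G i =
     PiE (states G \<times> histories k G) (\<lambda>_. {p. set_pmf p \<subseteq> actions G i})"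

definition joint_strategies ::
  "nat \<Rightarrow> ('i, 's, 'x) game \<Rightarrow> ('i \<Rightarrow> ('i, 's, 'x) strategy) set" where
  "joint_strategies k G = PiE (players G) (mixed_strategies k G)"

section \<open>Play\<close>

text \<open>
  A play is a sequence of pairs (state, joint action); entry n is the pair at time n.
  The kernel below may look at the first n entries of the play only.
\<close>

definition state_pmf ::
  "('i, 's, 'x) game \<Rightarrow> 'x \<Rightarrow> nat \<Rightarrow> (nat \<Rightarrow> 'x \<times> ('i \<Rightarrow> 's)) \<Rightarrow> 'x pmf" where
  "state_pmf G x n \<omega> =
     (case n of 0 \<Rightarrow> return_pmf x | Suc m \<Rightarrow> trans G (fst (\<omega> m)) (snd (\<omega> m)))"

definition recent_profiles ::
  "('i \<Rightarrow> 's) list \<Rightarrow> nat \<Rightarrow> (nat \<Rightarrow> 'x \<times> ('i \<Rightarrow> 's)) \<Rightarrow> ('i \<Rightarrow> 's) list" where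
  "recent_profiles h n \<omega> = take (length h) (map (\<lambda>m. snd (\<omega> m)) (rev [0..<n]) @ h)"

text \<open>
  Joint actions lie in a \<^const>\<open>PiE\<close> set, hence the default value \<^const>\<open>undefined\<close>
  outside the set of players.
\<close>

definition joint_action_pmf ::
  "('i, 's, 'x) game \<Rightarrow> ('i \<Rightarrow> ('i, 's, 'x) strategy) \<Rightarrow> 'x \<Rightarrow> ('i \<Rightarrow> 's) list
     \<Rightarrow> ('i \<Rightarrow> 's) pmf" where
  "joint_action_pmf G \<pi> y h = Pi_pmf (players G) undefined (\<lambda>i. \<pi> i (y, h))"

definition step_pmf ::
  "('i, 's, 'x) game \<Rightarrow> ('i \<Rightarrow> ('i, 's, 'x) strategy) \<Rightarrow> 'x \<Rightarrow> ('i \<Rightarrow> 's) list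
     \<Rightarrow> nat \<Rightarrow> (nat \<Rightarrow> 'x \<times> ('i \<Rightarrow> 's)) \<Rightarrow> ('x \<times> ('i \<Rightarrow> 's)) pmf" where
  "step_pmf G \<pi> x h n \<omega> =
     bind_pmf (state_pmf G x n \<omega>)
       (\<lambda>y. map_pmf (Pair y) (joint_action_pmf G \<pi> y (recent_profiles h n \<omega>)))"

definition stage_space :: "('i, 's, 'x) game \<Rightarrow> nat \<Rightarrow> ('x \<times> ('i \<Rightarrow> 's)) measure" where
  "stage_space G n = count_space (states G \<times> profiles G)"

definition step_kernel ::
  "('i, 's, 'x) game \<Rightarrow> ('i \<Rightarrow> ('i, 's, 'x) strategy) \<Rightarrow> 'x \<Rightarrow> ('i \<Rightarrow> 's) list
     \<Rightarrow> nat \<Rightarrow> (nat \<Rightarrow> 'x \<times> ('i \<Rightarrow> 's)) \<Rightarrow> ('x \<times> ('i \<Rightarrow> 's)) measure" where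
  "step_kernel G \<pi> x h n \<omega> =
     restrict_space (measure_pmf (step_pmf G \<pi> x h n \<omega>)) (states G \<times> profiles G)"

text \<open>The law of the play: the Ionescu-Tulcea measure of the kernels above.\<close>

definition play_measure ::
  "('i, 's, 'x) game \<Rightarrow> ('i \<Rightarrow> ('i, 's, 'x) strategy) \<Rightarrow> 'x \<Rightarrow> ('i \<Rightarrow> 's) list
     \<Rightarrow> (nat \<Rightarrow> 'x \<times> ('i \<Rightarrow> 's)) measure" where
  "play_measure G \<pi> x h =
     projective_family.lim UNIV
       (Ionescu_Tulcea.CI (step_kernel G \<pi> x h) (stage_space G)) (stage_space G)"

definition game_value ::
  "('i, 's, 'x) game \<Rightarrow> 'i \<Rightarrow> ('i \<Rightarrow> ('i, 's, 'x) strategy) \<Rightarrow> 'x \<Rightarrow> ('i \<Rightarrow> 's) list \<Rightarrow> real" where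
  "game_value G i \<pi> x h =
     (\<integral>\<omega>. (\<Sum>t. discount G i ^ t * payoff G i (fst (\<omega> t)) (snd (\<omega> t)))
        \<partial>play_measure G \<pi> x h)"

section \<open>Best responses, equilibria and satisficing paths\<close>

definition best_response ::
  "nat \<Rightarrow> ('i, 's, 'x) game \<Rightarrow> ('i \<Rightarrow> ('i, 's, 'x) strategy) \<Rightarrow> 'i \<Rightarrow> bool" where
  "best_response k G \<pi> i \<longleftrightarrow>
     (\<forall>x\<in>states G. \<forall>h\<in>histories k G.
        game_value G i \<pi> x h = (SUP \<tau>\<in>mixed_strategies k G i. game_value G i (\<pi>(i := \<tau>)) x h))"

definition mixed_equilibrium ::
  "nat \<Rightarrow> ('i, 's, 'x) game \<Rightarrow> ('i \<Rightarrow> ('i, 's, 'x) strategy) \<Rightarrow> bool" where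
  "mixed_equilibrium k G \<pi> \<longleftrightarrow>
     \<pi> \<in> joint_strategies k G \<and> (\<forall>i\<in>players G. best_response k G \<pi> i)"

definition satisficing_path ::
  "nat \<Rightarrow> ('i, 's, 'x) game \<Rightarrow> nat \<Rightarrow> (nat \<Rightarrow> 'i \<Rightarrow> ('i, 's, 'x) strategy) \<Rightarrow> bool" where
  "satisficing_path k G T \<sigma> \<longleftrightarrow>
     (\<forall>t\<le>T. \<sigma> t \<in> joint_strategies k G) \<and>
     (\<forall>t<T. \<forall>i\<in>players G. best_response k G (\<sigma> t) i \<longrightarrow> \<sigma> (Suc t) i = \<sigma> t i)"

section \<open>Well-definedness of the law of the play and of the value\<close>

lemma finite_profiles:
  assumes "stochastic_game G" "\<forall>i\<in>players G. finite (actions G i)"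
  shows "finite (profiles G)"
  using assms unfolding profiles_def stochastic_game_def by (auto intro!: finite_PiE)

lemma recent_profiles_in_histories:
  assumes "h \<in> histories k G" "\<And>m. m < n \<Longrightarrow> snd (\<omega> m) \<in> profiles G"
  shows "recent_profiles h n \<omega> \<in> histories k G"
  using assms unfolding recent_profiles_def histories_def
  by (auto dest!: in_set_takeD)

lemma set_step_pmf:
  assumes G: "stochastic_game G" and \<pi>: "\<pi> \<in> joint_strategies k G"
    and x: "x \<in> states G" and h: "h \<in> histories k G"
    and \<omega>: "\<And>m. m < n \<Longrightarrow> \<omega> m \<in> states G \<times> profiles G"
  shows "set_pmf (step_pmf G \<pi> x h n \<omega>) \<subseteq> states G \<times> profiles G"
proof -
  have fin: "finite (players G)" using G by (simp add: stochastic_game_def)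
  have st: "set_pmf (state_pmf G x n \<omega>) \<subseteq> states G"
  proof (cases n)
    case 0 then show ?thesis using x by (simp add: state_pmf_def)
  next
    case (Suc m)
    then have "\<omega> m \<in> states G \<times> profiles G" using \<omega> by simp
    then show ?thesis using G Suc by (auto simp: state_pmf_def stochastic_game_def mem_Times_iff)
  qed
  have rh: "recent_profiles h n \<omega> \<in> histories k G"
    using h by (rule recent_profiles_in_histories) (use \<omega> in \<open>auto simp: mem_Times_iff\<close>)
  have "set_pmf (joint_action_pmf G \<pi> y (recent_profiles h n \<omega>)) \<subseteq> profiles G"
    if y: "y \<in> states G" for y
  proof
    fix s assume "s \<in> set_pmf (joint_action_pmf G \<pi> y (recent_profiles h n \<omega>))"
    then have s: "s \<in> PiE_dflt (players G) undefined (set_pmf \<circ> (\<lambda>i. \<pi> i (y, recent_profiles h n \<omega>)))"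
      by (simp add: joint_action_pmf_def set_Pi_pmf[OF fin])
    have "set_pmf (\<pi> i (y, recent_profiles h n \<omega>)) \<subseteq> actions G i" if "i \<in> players G" for i
    proof -
      have "\<pi> i \<in> mixed_strategies k G i"
        using \<pi> that unfolding joint_strategies_def by (rule PiE_mem)
      then have "\<pi> i (y, recent_profiles h n \<omega>) \<in> {p. set_pmf p \<subseteq> actions G i}"
        unfolding mixed_strategies_def by (rule PiE_mem) (use y rh in auto)
      then show ?thesis by simp
    qed
    with s show "s \<in> profiles G"
      unfolding profiles_def PiE_dflt_def by (intro PiE_I) (auto dest!: subsetD)
  qed
  with st show ?thesis unfolding step_pmf_def by (simp add: image_subset_iff subset_iff) blast
qed

lemma Ionescu_Tulcea_step_kernel:
  assumes G: "stochastic_game G" "\<forall>i\<in>players G. finite (actions G i)"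
    and \<pi>: "\<pi> \<in> joint_strategies k G"
    and x: "x \<in> states G" and h: "h \<in> histories k G"
  shows "Ionescu_Tulcea (step_kernel G \<pi> x h) (stage_space G)"
proof -
  let ?A = "states G \<times> profiles G"
  have finA: "finite ?A"
    using finite_profiles[OF G] G(1) by (simp add: stochastic_game_def)
  have PiM: "PiM {0..<n} (stage_space G) = count_space (PiE {0..<n} (\<lambda>_. ?A))" for n
    unfolding stage_space_def[abs_def]
    by (rule count_space_PiM_finite) (simp, rule countable_finite[OF finA])
  have prob: "prob_space (step_kernel G \<pi> x h n \<omega>)" if "\<omega> \<in> PiE {0..<n} (\<lambda>_. ?A)" for n \<omega>
  proof -
    have "set_pmf (step_pmf G \<pi> x h n \<omega>) \<subseteq> ?A"
      by (rule set_step_pmf[OF G(1) \<pi> x h]) (rule PiE_mem[OF that], simp)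
    then have "measure_pmf.prob (step_pmf G \<pi> x h n \<omega>) ?A = 1"
      by (intro measure_pmf.prob_eq_1[THEN iffD2]) (auto simp: AE_measure_pmf_iff)
    then show ?thesis unfolding step_kernel_def
      by (intro prob_space_restrict_space) (simp_all add: measure_pmf.emeasure_eq_measure)
  qed
  show ?thesis
  proof (rule Ionescu_Tulcea.intro)
    fix n
    show "step_kernel G \<pi> x h n \<in> PiM {0..<n} (stage_space G) \<rightarrow>\<^sub>M subprob_algebra (stage_space G n)"
      unfolding PiM measurable_count_space_eq1
    proof (rule Pi_I)
      fix \<omega> assume "\<omega> \<in> PiE {0..<n} (\<lambda>_. ?A)"
      then interpret prob_space "step_kernel G \<pi> x h n \<omega>" by (rule prob)
      have "subprob_space (step_kernel G \<pi> x h n \<omega>)" by unfold_locales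
      then show "step_kernel G \<pi> x h n \<omega> \<in> space (subprob_algebra (stage_space G n))"
        by (auto simp: space_subprob_algebra stage_space_def step_kernel_def sets_restrict_space)
    qed
  next
    fix n \<omega> assume "\<omega> \<in> space (PiM {0..<n} (stage_space G))"
    then show "prob_space (step_kernel G \<pi> x h n \<omega>)"
      unfolding PiM by (simp add: prob)
  qed
qed

lemma
  assumes "stochastic_game G" "\<forall>i\<in>players G. finite (actions G i)"
    and "\<pi> \<in> joint_strategies k G" "x \<in> states G" "h \<in> histories k G"
  shows prob_space_play_measure: "prob_space (play_measure G \<pi> x h)"
    and sets_play_measure: "sets (play_measure G \<pi> x h) = sets (PiM UNIV (stage_space G))"
    and distr_play_measure: "distr (play_measure G \<pi> x h) (PiM {0..<n} (stage_space G))
           (\<lambda>\<omega>. restrict \<omega> {0..<n}) =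
         Ionescu_Tulcea.C (step_kernel G \<pi> x h) (stage_space G) 0 n (\<lambda>_. undefined)"
proof -
  interpret IT: Ionescu_Tulcea "step_kernel G \<pi> x h" "stage_space G"
    by (rule Ionescu_Tulcea_step_kernel[OF assms])
  have lim: "play_measure G \<pi> x h = IT.PF.lim" by (simp add: play_measure_def)
  show sets: "sets (play_measure G \<pi> x h) = sets (PiM UNIV (stage_space G))"
    unfolding lim by (rule IT.PF.sets_lim)
  have m: "(\<lambda>\<omega>. restrict \<omega> J) \<in> play_measure G \<pi> x h \<rightarrow>\<^sub>M PiM J (stage_space G)" for J
    unfolding measurable_cong_sets[OF sets refl]
    by (rule measurable_restrict_subset) simp
  show "prob_space (play_measure G \<pi> x h)"
  proof (rule prob_space_distrD[OF m])
    show "prob_space (distr (play_measure G \<pi> x h) (PiM {} (stage_space G)) (\<lambda>\<omega>. restrict \<omega> {}))"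
      unfolding lim by (simp only: IT.distr_lim[OF finite.emptyI]) (rule IT.PF.prob_space_P; simp)
  qed
  have up: "IT.up_to {0..<n} = n"
    using IT.up_to_iff[of "{0..<n}" n] IT.up_to_less[of "{0..<n}" "n - 1"] by (cases n) auto
  have "distr (play_measure G \<pi> x h) (PiM {0..<n} (stage_space G)) (\<lambda>\<omega>. restrict \<omega> {0..<n})
      = IT.CI {0..<n}"
    unfolding lim by (rule IT.distr_lim) simp
  also have "\<dots> = IT.C 0 n (\<lambda>_. undefined)"
    using IT.distr_C[of n n "\<lambda>_. undefined" 0] by (simp add: IT.CI_def up space_PiM)
  finally show "distr (play_measure G \<pi> x h) (PiM {0..<n} (stage_space G))
           (\<lambda>\<omega>. restrict \<omega> {0..<n}) = IT.C 0 n (\<lambda>_. undefined)" .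
qed

lemma
  assumes G: "stochastic_game G" "\<forall>i\<in>players G. finite (actions G i)" and i: "i \<in> players G"
    and B: "\<And>y s. y \<in> states G \<Longrightarrow> s \<in> profiles G \<Longrightarrow> \<bar>payoff G i y s\<bar> \<le> B"
    and \<pi>: "\<pi> \<in> joint_strategies k G" and x: "x \<in> states G" and h: "h \<in> histories k G"
  shows abs_game_value_le: "\<bar>game_value G i \<pi> x h\<bar> \<le> B / (1 - discount G i)"
    and integrable_discounted_payoff: "integrable (play_measure G \<pi> x h)
           (\<lambda>\<omega>. \<Sum>t. discount G i ^ t * payoff G i (fst (\<omega> t)) (snd (\<omega> t)))" (is "integrable _ ?f")
proof -
  interpret prob_space "play_measure G \<pi> x h"
    by (rule prob_space_play_measure[OF G \<pi> x h])
  have d: "0 \<le> discount G i" "discount G i < 1" using G(1) i by (auto simp: stochastic_game_def)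
  have sp: "space (play_measure G \<pi> x h) = PiE UNIV (\<lambda>_. states G \<times> profiles G)"
    using sets_eq_imp_space_eq[OF sets_play_measure[OF G \<pi> x h]]
    by (simp add: space_PiM stage_space_def)
  have bound: "norm (?f \<omega>) \<le> B / (1 - discount G i)" if "\<omega> \<in> space (play_measure G \<pi> x h)" for \<omega>
  proof -
    have \<omega>: "\<omega> t \<in> states G \<times> profiles G" for t using that unfolding sp by auto
    have le: "norm (discount G i ^ t * payoff G i (fst (\<omega> t)) (snd (\<omega> t))) \<le> discount G i ^ t * B" for t
      using B[of "fst (\<omega> t)" "snd (\<omega> t)"] \<omega>[of t] d
      by (auto simp: abs_mult mem_Times_iff intro!: mult_left_mono)
    have S: "(\<lambda>t. discount G i ^ t * B) sums (1 / (1 - discount G i) * B)"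
      using d by (intro sums_mult2 geometric_sums) auto
    have "norm (?f \<omega>) \<le> (\<Sum>t. discount G i ^ t * B)"
      by (rule norm_suminf_le[OF le sums_summable[OF S]])
    also have "\<dots> = B / (1 - discount G i)" using sums_unique[OF S] by simp
    finally show ?thesis .
  qed
  have "(\<lambda>\<omega>. \<omega> t) \<in> play_measure G \<pi> x h \<rightarrow>\<^sub>M count_space (states G \<times> profiles G)" for t
    unfolding measurable_cong_sets[OF sets_play_measure[OF G \<pi> x h] refl]
    using measurable_component_singleton[of t UNIV "stage_space G"] by (simp add: stage_space_def)
  then have "(\<lambda>\<omega>. case \<omega> t of (y, s) \<Rightarrow> payoff G i y s) \<in> borel_measurable (play_measure G \<pi> x h)" for t
    by (rule measurable_compose) simp
  then have [measurable]: "(\<lambda>\<omega>. payoff G i (fst (\<omega> t)) (snd (\<omega> t))) \<in> borel_measurable (play_measure G \<pi> x h)" for t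
    by (simp add: case_prod_beta)
  have meas: "?f \<in> borel_measurable (play_measure G \<pi> x h)" by measurable
  show int: "integrable (play_measure G \<pi> x h) ?f"
    by (rule integrable_const_bound[OF _ meas]) (use bound in auto)
  have "norm (\<integral>\<omega>. ?f \<omega> \<partial>play_measure G \<pi> x h) \<le> (\<integral>\<omega>. norm (?f \<omega>) \<partial>play_measure G \<pi> x h)"
    by (rule integral_norm_bound)
  also have "\<dots> \<le> (\<integral>\<omega>. B / (1 - discount G i) \<partial>play_measure G \<pi> x h)"
    by (rule integral_mono) (use int bound in auto)
  finally show "\<bar>game_value G i \<pi> x h\<bar> \<le> B / (1 - discount G i)"
    by (simp add: game_value_def prob_space)
qed

end

theory Submission
  imports Defs
begin

text \<open>
  Among the strategies reachable from \<open>\<sigma>\<close> by satisficing paths take one with as many unsatisfied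
  players as possible, and let \<open>U\<close> be the set of these players. Unsatisfaction is an open condition, so
  after a small move the players in \<open>U\<close> are fully mixed and, by maximality, still exactly the
  unsatisfied ones. Let them jump to an equilibrium \<open>\<rho>\<close> of the game in which the other players are
  frozen. If some other player were unsatisfied at \<open>\<rho>\<close>, then moving not to \<open>\<rho>\<close> but to a nearby point of
  the segment from \<open>\<rho>\<close> would keep that player unsatisfied; and it would keep all of \<open>U\<close> unsatisfied,
  because for a fully mixed player being satisfied is a system of equations between values, which are
  rational functions along the segment, and these equations fail at its other end. This contradicts
  maximality, so \<open>\<rho>\<close> is an equilibrium of the whole game.

  With the pair of current state and recent joint actions as a node, \<open>k\<close>-step strategies are stationary
  strategies of a finite discounted game, whose values are fixed points of a contraction.
\<close>

section \<open>Brouwer's theorem on finite-dimensional cubes\<close>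

text \<open>Bolzano-Weierstrass for a cube indexed by any finite set. Each new coordinate thins the
  subsequence once more, which preserves the limits already found.\<close>

lemma convergent_subseq_unit_cube:
  fixes x :: "nat \<Rightarrow> 'j \<Rightarrow> real"
  assumes "finite J" "\<And>n j. j \<in> J \<Longrightarrow> x n j \<in> {0..1}"
  shows "\<exists>l r. strict_mono (r :: nat \<Rightarrow> nat) \<and>
    (\<forall>j\<in>J. l j \<in> {0..1} \<and> (\<lambda>n. x (r n) j) \<longlonglongrightarrow> l j)"
  using assms
proof (induction J)
  case empty
  show ?case by (intro exI[of _ "\<lambda>_. 0"] exI[of _ id]) (auto simp: strict_mono_def)
next
  case (insert j J)
  then obtain l r where r: "strict_mono (r :: nat \<Rightarrow> nat)"
    and l: "\<And>i. i \<in> J \<Longrightarrow> l i \<in> {0..1} \<and> (\<lambda>n. x (r n) i) \<longlonglongrightarrow> l i"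
    by (metis insertI2)
  have "\<forall>n. x (r n) j \<in> {0..1}" using insert.prems by simp
  then obtain c r' where c: "c \<in> {0..1}" and r': "strict_mono (r' :: nat \<Rightarrow> nat)"
    and conv: "((\<lambda>n. x (r n) j) \<circ> r') \<longlonglongrightarrow> c"
    using compact_imp_seq_compact[OF compact_Icc[of 0 "1::real"], unfolded seq_compact_def, rule_format, of "\<lambda>n. x (r n) j"]
    by auto
  have "(\<lambda>n. x (r (r' n)) i) \<longlonglongrightarrow> l i" if "i \<in> J" for i
    using LIMSEQ_subseq_LIMSEQ[OF conjunct2[OF l[OF that]] r'] by (simp add: o_def)
  then show ?case
    using l c conv insert.hyps strict_mono_o[OF r r']
    by (intro exI[of _ "l(j := c)"] exI[of _ "r \<circ> r'"]) (auto simp: o_def)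
qed

text \<open>Brouwer's theorem for a cube whose dimension is not tied to a type: the library version is
  restricted to \<^class>\<open>euclidean_space\<close>, but the combinatorial lemma behind it is not.\<close>

lemma brouwer_unit_cube_nat:
  fixes f :: "(nat \<Rightarrow> real) \<Rightarrow> nat \<Rightarrow> real"
  assumes maps: "\<And>x. (\<And>i. i < n \<Longrightarrow> x i \<in> {0..1}) \<Longrightarrow> (\<And>i. i < n \<Longrightarrow> f x i \<in> {0..1})"
    and cont: "\<And>X x. (\<And>m i. i < n \<Longrightarrow> X m i \<in> {0..1}) \<Longrightarrow> (\<And>i. i < n \<Longrightarrow> x i \<in> {0..1}) \<Longrightarrow>
      (\<And>i. i < n \<Longrightarrow> (\<lambda>m. X m i) \<longlonglongrightarrow> x i) \<Longrightarrow> (\<And>i. i < n \<Longrightarrow> (\<lambda>m. f (X m) i) \<longlonglongrightarrow> f x i)"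
  shows "\<exists>x. \<forall>i<n. x i \<in> {0..1} \<and> f x i = x i"
proof -
  \<comment> \<open>\<open>pt p q\<close> is the grid point q/p. A label is 0 where \<open>f\<close>
    does not push the coordinate down and 1 otherwise, except that two opposite faces carry the
    fixed labels that \<open>kuhn_lemma\<close> asks for. Since \<open>f\<close> maps the cube to
    itself, the weak inequalities \<open>label0\<close> and \<open>label1\<close> hold on these
    faces too.\<close>
  define pt :: "nat \<Rightarrow> (nat \<Rightarrow> nat) \<Rightarrow> nat \<Rightarrow> real" where "pt p q i = real (q i) / real p" for p q i
  define label :: "nat \<Rightarrow> (nat \<Rightarrow> nat) \<Rightarrow> nat \<Rightarrow> nat" where
    "label p q i = (if q i = 0 \<or> (q i \<noteq> p \<and> pt p q i \<le> f (pt p q) i) then 0 else 1)" for p q i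
  have pt01: "pt p q i \<in> {0..1}" if "q i \<le> p" for p q i
    using that unfolding pt_def by (cases "p = 0") auto
  have label0: "pt p q i \<le> f (pt p q) i" if "label p q i = 0" "\<forall>j<n. q j \<le> p" "i < n" for p q i
  proof -
    have "f (pt p q) i \<in> {0..1}" using that by (intro maps pt01) auto
    then show ?thesis using that by (auto simp: label_def pt_def split: if_splits)
  qed
  have label1: "f (pt p q) i \<le> pt p q i" if "label p q i \<noteq> 0" "\<forall>j<n. q j \<le> p" "i < n" for p q i
  proof -
    have "f (pt p q) i \<in> {0..1}" using that by (intro maps pt01) auto
    then show ?thesis using that by (auto simp: label_def pt_def split: if_splits)
  qed
  \<comment> \<open>\<open>nbr q r\<close> says that \<open>r\<close> is a corner of the grid cell
    whose lowest corner is \<open>q\<close>.\<close>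
  define nbr where "nbr q r \<longleftrightarrow> (\<forall>j<n. q j \<le> r j \<and> r j \<le> q j + 1)" for q r :: "nat \<Rightarrow> nat"
  have "\<exists>q. (\<forall>i<n. q i < p) \<and> (\<forall>i<n. \<exists>r s. nbr q r \<and> nbr q s \<and> label p r i = 0 \<and> label p s i \<noteq> 0)"
    if p: "p > 0" for p
  proof -
    obtain q where q: "\<forall>i<n. q i < p"
      "\<forall>i<n. \<exists>r s. nbr q r \<and> nbr q s \<and> label p r i \<noteq> label p s i"
      unfolding nbr_def conj_assoc
      by (rule kuhn_lemma[where p = p and n = n and label = "label p", unfolded conj_assoc])
        (use p in \<open>auto simp: label_def\<close>)
    have "\<exists>r s. nbr q r \<and> nbr q s \<and> label p r i = 0 \<and> label p s i \<noteq> 0" if i: "i < n" for i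
    proof -
      obtain r s where rs: "nbr q r" "nbr q s" "label p r i \<noteq> label p s i" using q(2) i by blast
      have "label p u i = 0 \<or> label p u i = 1" for u by (simp add: label_def)
      then have "label p r i = 0 \<and> label p s i \<noteq> 0 \<or> label p s i = 0 \<and> label p r i \<noteq> 0"
        using rs(3) by (metis zero_neq_one)
      with rs show ?thesis by blast
    qed
    with q(1) show ?thesis by blast
  qed
  then have "\<forall>p. \<exists>q. (\<forall>i<n. q i < Suc p) \<and>
      (\<forall>i<n. \<exists>r s. nbr q r \<and> nbr q s \<and> label (Suc p) r i = 0 \<and> label (Suc p) s i \<noteq> 0)"
    by blast
  from choice[OF this] obtain Q where Q: "\<And>p i. i < n \<Longrightarrow> Q p i < Suc p"
    and "\<And>p i. i < n \<Longrightarrow> \<exists>r s. nbr (Q p) r \<and> nbr (Q p) s \<and> label (Suc p) r i = 0 \<and> label (Suc p) s i \<noteq> 0"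
    by blast
  \<comment> \<open>Every coordinate \<open>i\<close> has its own pair of corners of the cell
    \<open>Q p\<close>: \<open>R i p\<close> with label 0 and \<open>S i p\<close> with nonzero
    label in that coordinate.\<close>
  then obtain R S where "\<And>i p. i < n \<Longrightarrow> nbr (Q p) (R i p)" "\<And>i p. i < n \<Longrightarrow> nbr (Q p) (S i p)"
    and lab: "\<And>i p. i < n \<Longrightarrow> label (Suc p) (R i p) i = 0" "\<And>i p. i < n \<Longrightarrow> label (Suc p) (S i p) i \<noteq> 0"
    by metis
  then have RQ: "\<And>i p j. i < n \<Longrightarrow> j < n \<Longrightarrow> Q p j \<le> R i p j \<and> R i p j \<le> Q p j + 1"
    and SQ: "\<And>i p j. i < n \<Longrightarrow> j < n \<Longrightarrow> Q p j \<le> S i p j \<and> S i p j \<le> Q p j + 1"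
    by (simp_all add: nbr_def)
  have R_le: "R i p j \<le> Suc p" and S_le: "S i p j \<le> Suc p" if "i < n" "j < n" for i p j
    using RQ[OF that, of p] SQ[OF that, of p] Q[OF that(2), of p] by linarith+
  obtain x r where r: "strict_mono (r :: nat \<Rightarrow> nat)"
    and x: "\<And>j. j < n \<Longrightarrow> x j \<in> {0..1}" "\<And>j. j < n \<Longrightarrow> (\<lambda>m. pt (Suc (r m)) (Q (r m)) j) \<longlonglongrightarrow> x j"
    using convergent_subseq_unit_cube[of "{..<n}" "\<lambda>p. pt (Suc p) (Q p)"] pt01 Q[THEN less_imp_le]
    by (simp del: atLeastAtMost_iff) blast
  \<comment> \<open>In each coordinate the corners of a cell are within 1/(p+1) of its lowest
    corner, so every choice of corners converges to the same limit \<open>x\<close>.\<close>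
  have near: "(\<lambda>m. pt (Suc (r m)) (T (r m)) j) \<longlonglongrightarrow> x j"
    if j: "j < n" and T: "\<And>p. Q p j \<le> T p j \<and> T p j \<le> Q p j + 1" for T j
  proof -
    have "(\<lambda>m. inverse (real (Suc m))) \<longlonglongrightarrow> 0" by (rule LIMSEQ_inverse_real_of_nat)
    from LIMSEQ_subseq_LIMSEQ[OF this r] have 0: "(\<lambda>m. 1 / real (Suc (r m))) \<longlonglongrightarrow> 0"
      by (simp add: o_def inverse_eq_divide)
    have "pt (Suc p) (Q p) j \<le> pt (Suc p) (T p) j"
      "pt (Suc p) (T p) j \<le> pt (Suc p) (Q p) j + 1 / real (Suc p)" for p
      using T[of p] unfolding pt_def add_divide_distrib[symmetric]
      by (auto intro!: divide_right_mono simp del: of_nat_Suc)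
    then show ?thesis
      by (intro tendsto_sandwich[OF _ _ x(2)[OF j], of "\<lambda>m. pt (Suc (r m)) (T (r m)) j"
            "\<lambda>m. pt (Suc (r m)) (Q (r m)) j + 1 / real (Suc (r m))"])
        (use tendsto_add[OF x(2)[OF j] 0] in \<open>auto intro!: always_eventually\<close>)
  qed
  have "f x i = x i" if i: "i < n" for i
  proof (rule antisym)
    have fR: "(\<lambda>m. f (pt (Suc (r m)) (R i (r m))) i) \<longlonglongrightarrow> f x i"
      using RQ[OF i] R_le[OF i] x(1) i by (intro cont near pt01) auto
    have fS: "(\<lambda>m. f (pt (Suc (r m)) (S i (r m))) i) \<longlonglongrightarrow> f x i"
      using SQ[OF i] S_le[OF i] x(1) i by (intro cont near pt01) auto
    \<comment> \<open>The label inequalities pass to the limit: label 0 gives one direction, label 1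
      the other.\<close>
    show "x i \<le> f x i"
      by (rule LIMSEQ_le[OF near[where T = "R i", OF i RQ[OF i i]] fR]) (use lab i R_le label0 in auto)
    show "f x i \<le> x i"
      by (rule LIMSEQ_le[OF fS near[where T = "S i", OF i SQ[OF i i]]]) (use lab i S_le label1 in auto)
  qed
  with x(1) show ?thesis by blast
qed

text \<open>The coordinates are renumbered along an enumeration \<open>e\<close> of
  \<open>J\<close>. Both hypotheses speak of coordinates in \<open>J\<close> alone, so they survive
  precomposition with \<open>d\<close>, whose values outside \<open>J\<close> are arbitrary.\<close>

lemma brouwer_unit_cube:
  fixes f :: "('j \<Rightarrow> real) \<Rightarrow> 'j \<Rightarrow> real"
  assumes J: "finite J"
    and maps: "\<And>x. (\<And>j. j \<in> J \<Longrightarrow> x j \<in> {0..1}) \<Longrightarrow> (\<And>j. j \<in> J \<Longrightarrow> f x j \<in> {0..1})"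
    and cont: "\<And>X x. (\<And>m j. j \<in> J \<Longrightarrow> X m j \<in> {0..1}) \<Longrightarrow> (\<And>j. j \<in> J \<Longrightarrow> x j \<in> {0..1}) \<Longrightarrow>
      (\<And>j. j \<in> J \<Longrightarrow> (\<lambda>m. X m j) \<longlonglongrightarrow> x j) \<Longrightarrow> (\<And>j. j \<in> J \<Longrightarrow> (\<lambda>m. f (X m) j) \<longlonglongrightarrow> f x j)"
  shows "\<exists>x. \<forall>j\<in>J. x j \<in> {0..1} \<and> f x j = x j"
proof -
  obtain e where e: "bij_betw e {..<card J} J"
    using ex_bij_betw_nat_finite[OF J] by (auto simp: atLeast0LessThan)
  define d where "d = the_inv_into {..<card J} e"
  have de: "d (e i) = i" if "i < card J" for i
    using e that by (simp add: d_def bij_betw_def the_inv_into_f_f)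
  have ed: "e (d j) = j" and d: "d j < card J" if "j \<in> J" for j
    using e that by (auto simp: d_def bij_betw_def f_the_inv_into_f dest: the_inv_into_into[of e "{..<card J}" j "{..<card J}"])
  have eJ: "e i \<in> J" if "i < card J" for i using e that by (auto simp: bij_betw_def)
  have "f (\<lambda>j. y (d j)) (e i) \<in> {0..1}" if "\<And>i. i < card J \<Longrightarrow> y i \<in> {0..1}" "i < card J" for y i
    by (rule maps[OF _ eJ]) (use that d in auto)
  moreover have "(\<lambda>m. f (\<lambda>j. X m (d j)) (e i)) \<longlonglongrightarrow> f (\<lambda>j. x (d j)) (e i)"
    if "\<And>m i. i < card J \<Longrightarrow> X m i \<in> {0..1}" "\<And>i. i < card J \<Longrightarrow> x i \<in> {0..1}"
      "\<And>i. i < card J \<Longrightarrow> (\<lambda>m. X m i) \<longlonglongrightarrow> x i" "i < card J" for X x i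
    by (rule cont[of "\<lambda>m j. X m (d j)" "\<lambda>j. x (d j)", OF _ _ _ eJ]) (use that d in auto)
  ultimately have "\<exists>y. \<forall>i<card J. y i \<in> {0..1} \<and> f (\<lambda>j. y (d j)) (e i) = y i"
    by (rule brouwer_unit_cube_nat)
  then obtain y where y: "\<And>i. i < card J \<Longrightarrow> y i \<in> {0..1} \<and> f (\<lambda>j. y (d j)) (e i) = y i"
    by blast
  show ?thesis
  proof (intro exI[of _ "\<lambda>j. y (d j)"] ballI)
    fix j assume "j \<in> J"
    then show "y (d j) \<in> {0..1} \<and> f (\<lambda>j. y (d j)) j = y (d j)"
      using y[OF d] ed by metis
  qed
qed

section \<open>Rational functions and parametrised linear systems\<close>

definition rational_on_unit :: "(real \<Rightarrow> real) \<Rightarrow> bool" where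
  "rational_on_unit f \<longleftrightarrow> (\<exists>p q. \<forall>t\<in>{0..1}. poly q t \<noteq> 0 \<and> f t = poly p t / poly q t)"

lemma rational_on_unit_const: "rational_on_unit (\<lambda>t. c)"
  unfolding rational_on_unit_def by (intro exI[of _ "[:c:]"] exI[of _ 1]) simp

lemma rational_on_unit_ident: "rational_on_unit (\<lambda>t. t)"
  unfolding rational_on_unit_def by (intro exI[of _ "[:0, 1:]"] exI[of _ 1]) simp

lemma rational_on_unit_add:
  assumes "rational_on_unit f" "rational_on_unit g"
  shows "rational_on_unit (\<lambda>t. f t + g t)"
proof -
  obtain p q p' q' where "\<forall>t\<in>{0..1}. poly q t \<noteq> 0 \<and> f t = poly p t / poly q t"
    "\<forall>t\<in>{0..1}. poly q' t \<noteq> 0 \<and> g t = poly p' t / poly q' t"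
    using assms unfolding rational_on_unit_def by blast
  then show ?thesis unfolding rational_on_unit_def
    by (intro exI[of _ "p * q' + p' * q"] exI[of _ "q * q'"]) (simp add: add_frac_eq)
qed

lemma rational_on_unit_mult:
  assumes "rational_on_unit f" "rational_on_unit g"
  shows "rational_on_unit (\<lambda>t. f t * g t)"
proof -
  obtain p q p' q' where "\<forall>t\<in>{0..1}. poly q t \<noteq> 0 \<and> f t = poly p t / poly q t"
    "\<forall>t\<in>{0..1}. poly q' t \<noteq> 0 \<and> g t = poly p' t / poly q' t"
    using assms unfolding rational_on_unit_def by blast
  then show ?thesis unfolding rational_on_unit_def
    by (intro exI[of _ "p * p'"] exI[of _ "q * q'"]) simp
qed

lemma rational_on_unit_inverse:
  assumes "rational_on_unit f" "\<And>t. t \<in> {0..1} \<Longrightarrow> f t \<noteq> 0"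
  shows "rational_on_unit (\<lambda>t. inverse (f t))"
proof -
  obtain p q where *: "\<forall>t\<in>{0..1}. poly q t \<noteq> 0 \<and> f t = poly p t / poly q t"
    using assms(1) unfolding rational_on_unit_def by blast
  then have "\<forall>t\<in>{0..1}. poly p t \<noteq> 0" using assms(2) by fastforce
  with * show ?thesis unfolding rational_on_unit_def
    by (intro exI[of _ "q"] exI[of _ "p"]) simp
qed

lemma rational_on_unit_cong:
  assumes "rational_on_unit f" "\<And>t. t \<in> {0..1} \<Longrightarrow> f t = g t"
  shows "rational_on_unit g"
proof -
  obtain p q where "\<forall>t\<in>{0..1}. poly q t \<noteq> 0 \<and> f t = poly p t / poly q t"
    using assms(1) unfolding rational_on_unit_def by blast
  then show ?thesis using assms(2) unfolding rational_on_unit_def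
    by (intro exI[of _ p] exI[of _ q]) simp
qed

lemma rational_on_unit_sum:
  "(\<And>a. a \<in> A \<Longrightarrow> rational_on_unit (f a)) \<Longrightarrow> rational_on_unit (\<lambda>t. \<Sum>a\<in>A. f a t)"
  by (induction A rule: infinite_finite_induct)
     (auto intro: rational_on_unit_const rational_on_unit_add)

lemma rational_on_unit_prod:
  "(\<And>a. a \<in> A \<Longrightarrow> rational_on_unit (f a)) \<Longrightarrow> rational_on_unit (\<lambda>t. \<Prod>a\<in>A. f a t)"
  by (induction A rule: infinite_finite_induct)
     (auto intro: rational_on_unit_const rational_on_unit_mult)

lemma rational_on_unit_diff:
  "rational_on_unit f \<Longrightarrow> rational_on_unit g \<Longrightarrow> rational_on_unit (\<lambda>t. f t - g t)"
  using rational_on_unit_add[OF _ rational_on_unit_mult[OF rational_on_unit_const[of "-1"]], of f g] by simp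

text \<open>The numerator is nonzero at 1, hence a nonzero polynomial with finitely many roots, and
  0 is not a limit point of these. The value \<open>f 0\<close> may vanish: only a punctured
  neighbourhood matters.\<close>

lemma rational_on_unit_eventually_nonzero:
  assumes "rational_on_unit f" "f 1 \<noteq> 0"
  shows "\<forall>\<^sub>F t in at_right 0. f t \<noteq> 0"
proof -
  obtain p q where *: "\<And>t. t \<in> {0..1} \<Longrightarrow> poly q t \<noteq> 0 \<and> f t = poly p t / poly q t"
    using assms(1) unfolding rational_on_unit_def by blast
  then have "poly p 1 \<noteq> 0" using assms(2) by force
  then have "finite {t. poly p t = 0}" by (intro poly_roots_finite) auto
  then have "\<forall>\<^sub>F t in at 0. t \<notin> {t. poly p t = 0}"
    using islimpt_iff_eventually islimpt_finite by blast
  then have "\<forall>\<^sub>F t in at_right 0. poly p t \<noteq> 0"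
    by (auto simp: eventually_at_split)
  moreover have "\<forall>\<^sub>F t in at_right (0::real). t \<in> {0..1}"
    using eventually_at_right_real[of 0 "1::real"] by (auto elim: eventually_mono)
  ultimately show ?thesis
    by eventually_elim (use * in auto)
qed

text \<open>Eliminating one unknown keeps the coefficients nonnegative and the row sums at most \<open>\<gamma>\<close>,
  so the pivots \<open>1 - A z z t\<close> never vanish.\<close>

lemma rational_on_unit_linear_system:
  assumes "finite Z" "\<gamma> < 1"
    and "\<And>z w. z \<in> Z \<Longrightarrow> w \<in> Z \<Longrightarrow> rational_on_unit (A z w)"
    and "\<And>z. z \<in> Z \<Longrightarrow> rational_on_unit (b z)"
    and "\<And>z w t. z \<in> Z \<Longrightarrow> w \<in> Z \<Longrightarrow> t \<in> {0..1} \<Longrightarrow> 0 \<le> A z w t"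
    and "\<And>z t. z \<in> Z \<Longrightarrow> t \<in> {0..1} \<Longrightarrow> (\<Sum>w\<in>Z. A z w t) \<le> \<gamma>"
    and "\<And>z t. z \<in> Z \<Longrightarrow> t \<in> {0..1} \<Longrightarrow> v z t = b z t + (\<Sum>w\<in>Z. A z w t * v w t)"
    and "z \<in> Z"
  shows "rational_on_unit (v z)"
  using assms(1,3-)
proof (induction Z arbitrary: A b z)
  case empty
  then show ?case by simp
next
  case (insert y Z)
  \<comment> \<open>Gaussian elimination of the unknown \<open>y\<close>; \<open>c\<close> is the
    inverse of its pivot.\<close>
  define c where "c t = inverse (1 - A y y t)" for t
  have rowsum: "A z y t + (\<Sum>w\<in>Z. A z w t) \<le> \<gamma>" if "z \<in> insert y Z" "t \<in> {0..1}" for z t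
    using insert.prems(4)[OF that] insert.hyps by simp
  have Ayy: "A y y t \<le> \<gamma>" if "t \<in> {0..1}" for t
  proof -
    have "0 \<le> (\<Sum>w\<in>Z. A y w t)" using that insert.prems(3) by (intro sum_nonneg) auto
    with rowsum[of y t] that show ?thesis by simp
  qed
  have c: "c t > 0" "c t * (1 - A y y t) = 1" if "t \<in> {0..1}" for t
    using Ayy[OF that] assms(2) by (auto simp: c_def)
  have "rational_on_unit c" unfolding c_def
    by (rule rational_on_unit_inverse, intro rational_on_unit_diff rational_on_unit_const insert.prems(1))
       (use Ayy assms(2) in force)+
  have vy: "v y t = c t * (b y t + (\<Sum>w\<in>Z. A y w t * v w t))" if "t \<in> {0..1}" for t
  proof -
    have "v y t * (1 - A y y t) = b y t + (\<Sum>w\<in>Z. A y w t * v w t)"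
      using insert.prems(5)[of y t] that insert.hyps by (simp add: algebra_simps)
    then show ?thesis using c(2)[OF that] by (metis mult.assoc mult.commute mult.right_neutral)
  qed
  \<comment> \<open>These coefficients arise by substituting \<open>vy\<close> into the equation of
    \<open>z\<close>; the second summand of \<open>A'\<close> is the detour from \<open>z\<close> to
    \<open>w\<close> through \<open>y\<close>.\<close>
  define A' where "A' z w t = A z w t + A z y t * (c t * A y w t)" for z w t
  define b' where "b' z t = b z t + A z y t * (c t * b y t)" for z t
  have IH: "rational_on_unit (v z)" if "z \<in> Z" for z
  proof (rule insert.IH[of A' b'])
    show "rational_on_unit (A' z w)" if "z \<in> Z" "w \<in> Z" for z w
      unfolding A'_def 
      by (intro rational_on_unit_add rational_on_unit_mult insert.prems(1) \<open>rational_on_unit c\<close>)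
        (use that in auto)
    show "rational_on_unit (b' z)" if "z \<in> Z" for z
      unfolding b'_def 
      by (intro rational_on_unit_add rational_on_unit_mult insert.prems(1,2) \<open>rational_on_unit c\<close>)
        (use that in auto)
    show "0 \<le> A' z w t" if "z \<in> Z" "w \<in> Z" "t \<in> {0..1}" for z w t
      unfolding A'_def using that insert.prems(3) c(1)[of t]
      by (intro add_nonneg_nonneg mult_nonneg_nonneg) auto
    show "(\<Sum>w\<in>Z. A' z w t) \<le> \<gamma>" if z: "z \<in> Z" and t: "t \<in> {0..1}" for z t
    proof -
      \<comment> \<open>The off-diagonal part of row \<open>y\<close> sums to at most the pivot, as
        \<open>\<gamma> < 1\<close>. So all detours through \<open>y\<close> together weigh at most
        \<open>A z y t\<close>, the entry that row \<open>z\<close> loses.\<close>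
      have "(\<Sum>w\<in>Z. A y w t) \<le> 1 - A y y t"
        using rowsum[of y t] t assms(2) by simp
      then have "c t * (\<Sum>w\<in>Z. A y w t) \<le> c t * (1 - A y y t)"
        using c(1)[OF t] by (intro mult_left_mono) auto
      then have "A z y t * (c t * (\<Sum>w\<in>Z. A y w t)) \<le> A z y t * 1"
        using insert.prems(3)[of z y t] z t c(2)[OF t] by (intro mult_left_mono) auto
      then show ?thesis using rowsum[of z t] z t
        by (simp add: A'_def sum.distrib sum_distrib_left)
    qed
    show "v z t = b' z t + (\<Sum>w\<in>Z. A' z w t * v w t)" if z: "z \<in> Z" and t: "t \<in> {0..1}" for z t
    proof -
      have "v z t = b z t + (A z y t * v y t + (\<Sum>w\<in>Z. A z w t * v w t))"
        using insert.prems(5)[of z t] z t insert.hyps by simp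
      also have "\<dots> = b' z t + (\<Sum>w\<in>Z. A' z w t * v w t)"
        by (simp add: vy[OF t] A'_def b'_def algebra_simps sum.distrib sum_distrib_left)
      finally show ?thesis .
    qed
  qed fact
  \<comment> \<open>Back substitution: \<open>vy\<close> expresses \<open>v y\<close> by unknowns
    already known to be rational.\<close>
  have "rational_on_unit (\<lambda>t. c t * (b y t + (\<Sum>w\<in>Z. A y w t * v w t)))"
    by (intro rational_on_unit_mult rational_on_unit_add rational_on_unit_sum
          \<open>rational_on_unit c\<close> insert.prems(1,2) IH) auto
  then have "rational_on_unit (v y)"
    by (rule rational_on_unit_cong) (simp add: vy)
  with IH insert.prems(6) show ?case by auto
qed

section \<open>The value as a fixed point\<close>

lemma pmf_bind_map_Pair:
  "pmf (bind_pmf p (\<lambda>y. map_pmf (Pair y) (q y))) (y, s) = pmf p y * pmf (q y) s"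
proof -
  have "pmf (map_pmf (Pair y') (q y')) (y, s) = (if y' = y then pmf (q y) s else 0)" for y'
    by (auto simp: pmf_map_inj' inj_on_def pmf_eq_0_set_pmf)
  then show ?thesis
    unfolding pmf_bind by (subst integral_measure_pmf_real[of "{y}"]) (auto split: if_splits)
qed

lemma recent_profiles_restrict: "recent_profiles h n (restrict \<omega> {0..<n}) = recent_profiles h n \<omega>"
proof -
  have "map (\<lambda>m. snd (restrict \<omega> {0..<n} m)) (rev [0..<n]) = map (\<lambda>m. snd (\<omega> m)) (rev [0..<n])"
    by (intro map_cong refl) simp
  then show ?thesis unfolding recent_profiles_def by (simp only:)
qed

text \<open>The window slides: the newest joint action enters in front and the oldest drops off the
  end. This is the update made by \<open>succ_node\<close>.\<close>

lemma recent_profiles_Suc: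
  "recent_profiles h (Suc n) \<omega> = take (length h) (snd (\<omega> n) # recent_profiles h n \<omega>)"
  unfolding recent_profiles_def by (cases h) (simp_all add: take_Cons')

locale finite_stochastic_game =
  fixes G :: "('i, 's, 'x) game" and k :: nat
  assumes game: "stochastic_game G" and finite_actions: "\<forall>i\<in>players G. finite (actions G i)"
begin

abbreviation nodes :: "('x \<times> ('i \<Rightarrow> 's) list) set" where
  "nodes \<equiv> states G \<times> histories k G"

abbreviation succ_node :: "'x \<times> ('i \<Rightarrow> 's) list \<Rightarrow> ('i \<Rightarrow> 's) \<Rightarrow> 'x \<Rightarrow> 'x \<times> ('i \<Rightarrow> 's) list" where
  "succ_node z s y \<equiv> (y, take k (s # snd z))"

abbreviation val :: "'i \<Rightarrow> ('i \<Rightarrow> ('i, 's, 'x) strategy) \<Rightarrow> 'x \<times> ('i \<Rightarrow> 's) list \<Rightarrow> real" where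
  "val i \<pi> z \<equiv> game_value G i \<pi> (fst z) (snd z)"

section \<open>Bellman operators on nodes\<close>

definition profile_prob ::
  "('i \<Rightarrow> ('i, 's, 'x) strategy) \<Rightarrow> 'x \<times> ('i \<Rightarrow> 's) list \<Rightarrow> ('i \<Rightarrow> 's) \<Rightarrow> real" where
  "profile_prob \<pi> z s = (\<Prod>j\<in>players G. pmf (\<pi> j z) (s j))"

definition look_ahead ::
  "'i \<Rightarrow> ('x \<times> ('i \<Rightarrow> 's) list \<Rightarrow> real) \<Rightarrow> 'x \<times> ('i \<Rightarrow> 's) list \<Rightarrow> ('i \<Rightarrow> 's) \<Rightarrow> real" where
  "look_ahead i v z s = payoff G i (fst z) s +
     discount G i * (\<Sum>y\<in>states G. pmf (trans G (fst z) s) y * v (succ_node z s y))"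

text \<open>The policy evaluation operator: it averages over \<open>\<pi>\<close> and takes no
  maximum, so it is affine in \<open>v\<close>.\<close>

definition bellman ::
  "'i \<Rightarrow> ('i \<Rightarrow> ('i, 's, 'x) strategy) \<Rightarrow> ('x \<times> ('i \<Rightarrow> 's) list \<Rightarrow> real)
     \<Rightarrow> 'x \<times> ('i \<Rightarrow> 's) list \<Rightarrow> real" where
  "bellman i \<pi> v z = (\<Sum>s\<in>profiles G. profile_prob \<pi> z s * look_ahead i v z s)"

lemma finite_players: "finite (players G)" and finite_states: "finite (states G)"
  using game by (auto simp: stochastic_game_def)

lemma finite_profiles': "finite (profiles G)"
  by (rule finite_profiles[OF game finite_actions])

lemma finite_nodes: "finite nodes"
  using finite_states finite_lists_length_eq[OF finite_profiles', of k]
  by (simp add: histories_def conj_commute)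

lemma discount: "i \<in> players G \<Longrightarrow> 0 \<le> discount G i" "i \<in> players G \<Longrightarrow> discount G i < 1"
  using game by (auto simp: stochastic_game_def)

lemma succ_node_in_nodes:
  "z \<in> nodes \<Longrightarrow> s \<in> profiles G \<Longrightarrow> y \<in> states G \<Longrightarrow> succ_node z s y \<in> nodes"
  by (auto simp: histories_def dest!: in_set_takeD)

lemma set_trans: "x \<in> states G \<Longrightarrow> s \<in> profiles G \<Longrightarrow> set_pmf (trans G x s) \<subseteq> states G"
  using game by (auto simp: stochastic_game_def)

lemma sum_trans: "x \<in> states G \<Longrightarrow> s \<in> profiles G \<Longrightarrow> (\<Sum>y\<in>states G. pmf (trans G x s) y) = 1"
  by (rule sum_pmf_eq_1[OF finite_states set_trans])

lemma set_strategy: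
  assumes "\<pi> \<in> joint_strategies k G" "i \<in> players G" "z \<in> nodes"
  shows "set_pmf (\<pi> i z) \<subseteq> actions G i"
proof -
  have "\<pi> i \<in> mixed_strategies k G i"
    using assms(1,2) unfolding joint_strategies_def by (rule PiE_mem)
  then have "\<pi> i z \<in> {p. set_pmf p \<subseteq> actions G i}"
    unfolding mixed_strategies_def using assms(3) by (rule PiE_mem)
  then show ?thesis by simp
qed

lemma profile_prob_nonneg: "0 \<le> profile_prob \<pi> z s"
  unfolding profile_prob_def by (intro prod_nonneg) simp

text \<open>A profile is \<open>undefined\<close> outside the set of players, which is exactly the
  default value given to \<open>Pi_pmf\<close>; hence the plain product formula.\<close>

lemma pmf_joint_action:
  "s \<in> profiles G \<Longrightarrow> pmf (joint_action_pmf G \<pi> y h) s = profile_prob \<pi> (y, h) s"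
  unfolding joint_action_pmf_def profile_prob_def profiles_def
  by (rule pmf_Pi'[OF finite_players]) (rule PiE_arb)

lemma set_joint_action:
  assumes "\<pi> \<in> joint_strategies k G" "z \<in> nodes"
  shows "set_pmf (joint_action_pmf G \<pi> (fst z) (snd z)) \<subseteq> profiles G"
proof
  fix s assume "s \<in> set_pmf (joint_action_pmf G \<pi> (fst z) (snd z))"
  then have "s \<in> PiE_dflt (players G) undefined (set_pmf \<circ> (\<lambda>i. \<pi> i z))"
    by (simp add: joint_action_pmf_def set_Pi_pmf[OF finite_players])
  then show "s \<in> profiles G"
    using set_strategy[OF assms(1) _ assms(2)]
    unfolding profiles_def PiE_dflt_def PiE_iff extensional_def by auto
qed

lemma sum_profile_prob:
  assumes "\<pi> \<in> joint_strategies k G" "z \<in> nodes"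
  shows "(\<Sum>s\<in>profiles G. profile_prob \<pi> z s) = 1"
proof -
  have "(\<Sum>s\<in>profiles G. profile_prob \<pi> z s)
      = (\<Sum>s\<in>profiles G. pmf (joint_action_pmf G \<pi> (fst z) (snd z)) s)"
    by (intro sum.cong) (simp_all add: pmf_joint_action)
  also have "\<dots> = 1"
    by (rule sum_pmf_eq_1[OF finite_profiles' set_joint_action[OF assms]])
  finally show ?thesis .
qed

section \<open>Conditioning the play on its first entries\<close>

lemma expectation_step:
  assumes \<pi>: "\<pi> \<in> joint_strategies k G" and z: "x \<in> states G" "h \<in> histories k G"
    and \<omega>: "\<And>m. m < n \<Longrightarrow> \<omega> m \<in> states G \<times> profiles G"
  shows "measure_pmf.expectation (step_pmf G \<pi> x h n \<omega>) f = 
    (\<Sum>y\<in>states G. pmf (state_pmf G x n \<omega>) y *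
       (\<Sum>s\<in>profiles G. profile_prob \<pi> (y, recent_profiles h n \<omega>) s * f (y, s)))"
proof -
  have sub: "set_pmf (step_pmf G \<pi> x h n \<omega>) \<subseteq> states G \<times> profiles G"
    by (rule set_step_pmf[OF game \<pi> z]) (rule \<omega>)
  have "measure_pmf.expectation (step_pmf G \<pi> x h n \<omega>) f =
      (\<Sum>e\<in>states G \<times> profiles G. f e * pmf (step_pmf G \<pi> x h n \<omega>) e)"
    by (rule integral_measure_pmf_real) (use sub finite_states finite_profiles' in auto)
  also have "\<dots> = (\<Sum>(y, s)\<in>states G \<times> profiles G. pmf (state_pmf G x n \<omega>) y *
       (profile_prob \<pi> (y, recent_profiles h n \<omega>) s * f (y, s)))"
    by (intro sum.cong refl)
       (auto simp: step_pmf_def pmf_bind_map_Pair pmf_joint_action)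
  finally show ?thesis
    by (simp add: sum.cartesian_product sum_distrib_left)
qed

text \<open>Both sides depend on finitely many entries of the play, so the play measure can be
  traded for its marginals, and the marginal of length \<open>Suc n\<close> is the bind of that of
  length \<open>n\<close> with the kernel. This is the Markov property in integrated form.\<close>

lemma integral_play_step:
  fixes \<phi> :: "(nat \<Rightarrow> 'x \<times> ('i \<Rightarrow> 's)) \<Rightarrow> 'x \<times> ('i \<Rightarrow> 's) \<Rightarrow> real"
  assumes \<pi>: "\<pi> \<in> joint_strategies k G" and z: "x \<in> states G" "h \<in> histories k G"
  shows "(\<integral>\<omega>. \<phi> (restrict \<omega> {0..<n}) (\<omega> n) \<partial>play_measure G \<pi> x h) =
    (\<integral>\<omega>. measure_pmf.expectation (step_pmf G \<pi> x h n \<omega>) (\<phi> (restrict \<omega> {0..<n})) \<partial>play_measure G \<pi> x h)"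
    (is "_ = ?R")
proof -
  let ?M = "stage_space G" and ?E = "states G \<times> profiles G" and ?P = "play_measure G \<pi> x h"
  interpret IT: Ionescu_Tulcea "step_kernel G \<pi> x h" ?M
    by (rule Ionescu_Tulcea_step_kernel[OF game finite_actions \<pi> z])
  have finE: "finite ?E" using finite_states finite_profiles' by simp
  \<comment> \<open>Finite products of these finite discrete spaces are discrete, so every real
    function of a prefix of the play is measurable.\<close>
  have PiM: "PiM {0..<n} ?M = count_space (PiE {0..<n} (\<lambda>_. ?E))" for n
    unfolding stage_space_def[abs_def]
    by (rule count_space_PiM_finite) (simp, rule countable_finite[OF finE])
  have meas [measurable]: "F \<in> borel_measurable (PiM {0..<n} ?M)" for F :: "_ \<Rightarrow> real" and n
    unfolding PiM by simp
  have restr: "(\<lambda>\<omega>. restrict \<omega> {0..<n}) \<in> ?P \<rightarrow>\<^sub>M PiM {0..<n} ?M" for n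
    unfolding measurable_cong_sets[OF sets_play_measure[OF game finite_actions \<pi> z] refl]
    by (rule measurable_restrict_subset) simp
  have C: "(\<integral>\<omega>. F (restrict \<omega> {0..<n}) \<partial>?P) = (\<integral>\<omega>. F \<omega> \<partial>IT.C 0 n (\<lambda>_. undefined))"
    for F :: "_ \<Rightarrow> real" and n
    unfolding distr_play_measure[OF game finite_actions \<pi> z, symmetric]
    by (rule integral_distr[symmetric, OF restr meas])
  have u: "(\<lambda>_. undefined) \<in> space (PiM {0..<0} ?M)" by (simp add: space_PiM)
  define \<Phi> where "\<Phi> \<eta> = \<phi> (restrict \<eta> {0..<n}) (\<eta> n)" for \<eta>
  \<comment> \<open>A finite range supplies the bound that \<open>integral_bind\<close> asks
    for.\<close>
  have "finite (\<Phi> ` space (PiM {0..<Suc n} ?M))"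
    unfolding PiM using finE by (auto intro!: finite_PiE)
  then obtain B where B: "\<And>\<eta>. \<eta> \<in> space (PiM {0..<Suc n} ?M) \<Longrightarrow> \<bar>\<Phi> \<eta>\<bar> \<le> B"
    by (meson finite_imp_bounded bounded_real imageI)
  have eP: "(\<integral>\<eta>. \<Phi> \<eta> \<partial>IT.eP n \<omega>) =
      measure_pmf.expectation (step_pmf G \<pi> x h n \<omega>) (\<phi> (restrict \<omega> {0..<n}))"
    if \<omega>: "\<omega> \<in> space (PiM {0..<n} ?M)" for \<omega>
  proof -
    have ext: "restrict \<omega> {0..<n} = \<omega>" and mem: "\<And>m. m < n \<Longrightarrow> \<omega> m \<in> ?E"
      using \<omega> unfolding PiM by (auto intro!: extensional_restrict simp: PiE_iff)
    have sub: "set_pmf (step_pmf G \<pi> x h n \<omega>) \<subseteq> ?E"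
      by (rule set_step_pmf[OF game \<pi> z]) (rule mem)
    have "(\<integral>\<eta>. \<Phi> \<eta> \<partial>IT.eP n \<omega>) = (\<integral>e. \<Phi> (fun_upd \<omega> n e) \<partial>step_kernel G \<pi> x h n \<omega>)"
      unfolding IT.eP_def
      by (rule integral_distr[OF _ meas])
        (use \<omega> in \<open>auto intro!: measurable_fun_upd[where J="{0..<n}"]\<close>)
    also have "\<dots> = (\<integral>e. \<phi> \<omega> e \<partial>step_kernel G \<pi> x h n \<omega>)"
      by (intro Bochner_Integration.integral_cong refl) (simp add: \<Phi>_def restrict_upd ext)
    also have "\<dots> = (\<integral>e. indicator ?E e *\<^sub>R \<phi> \<omega> e \<partial>measure_pmf (step_pmf G \<pi> x h n \<omega>))"
      unfolding step_kernel_def by (rule integral_restrict_space) simp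
    also have "\<dots> = (\<integral>e. \<phi> \<omega> e \<partial>measure_pmf (step_pmf G \<pi> x h n \<omega>))"
      using sub by (intro integral_cong_AE) (auto simp: AE_measure_pmf_iff indicator_def)
    finally show ?thesis by (simp only: ext)
  qed
  have sp: "space (IT.C 0 n (\<lambda>_. undefined)) = space (PiM {0..<n} ?M)"
    using IT.space_C[OF u, of n] by simp
  have setsC: "sets (IT.C 0 n (\<lambda>_. undefined)) = sets (PiM {0..<n} ?M)"
    using IT.sets_C[OF u, of n] by simp
  interpret pC: prob_space "IT.C 0 n (\<lambda>_. undefined)" by (rule IT.prob_space_C[OF u])
  have "(\<integral>\<omega>. \<phi> (restrict \<omega> {0..<n}) (\<omega> n) \<partial>?P) = (\<integral>\<omega>. \<Phi> (restrict \<omega> {0..<Suc n}) \<partial>?P)"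
    by (intro Bochner_Integration.integral_cong refl) (simp add: \<Phi>_def Int_absorb1)
  also have "\<dots> = (\<integral>\<eta>. \<Phi> \<eta> \<partial>(IT.C 0 n (\<lambda>_. undefined) \<bind> IT.eP n))"
    by (simp add: C)
  also have "\<dots> = (\<integral>\<omega>. (\<integral>\<eta>. \<Phi> \<eta> \<partial>IT.eP n \<omega>) \<partial>IT.C 0 n (\<lambda>_. undefined))"
  proof (rule integral_bind[OF meas B])
    show "IT.eP n \<in> IT.C 0 n (\<lambda>_. undefined) \<rightarrow>\<^sub>M subprob_algebra (PiM {0..<Suc n} ?M)"
      unfolding measurable_cong_sets[OF setsC refl] by (rule IT.measurable_eP)
    show "finite_measure (IT.C 0 n (\<lambda>_. undefined))" by unfold_locales
    show "AE \<omega> in IT.C 0 n (\<lambda>_. undefined). emeasure (IT.eP n \<omega>) (space (IT.eP n \<omega>)) \<le> ennreal 1"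
      using IT.prob_space_eP by (intro AE_I2) (auto simp: sp prob_space.emeasure_space_1)
  qed
  also have "\<dots> = (\<integral>\<omega>. measure_pmf.expectation (step_pmf G \<pi> x h n \<omega>) (\<phi> (restrict \<omega> {0..<n}))
      \<partial>IT.C 0 n (\<lambda>_. undefined))"
    by (intro Bochner_Integration.integral_cong refl) (simp add: sp eP)
  also have "\<dots> = (\<integral>\<omega>. measure_pmf.expectation (step_pmf G \<pi> x h n (restrict \<omega> {0..<n}))
      (\<phi> (restrict (restrict \<omega> {0..<n}) {0..<n})) \<partial>?P)"
    by (rule C[symmetric])
  also have "\<dots> = ?R"
  proof -
    have "state_pmf G x n (restrict \<omega> {0..<n}) = state_pmf G x n \<omega>" for \<omega>
      by (auto simp: state_pmf_def split: nat.splits)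
    then have "step_pmf G \<pi> x h n (restrict \<omega> {0..<n}) = step_pmf G \<pi> x h n \<omega>" for \<omega>
      unfolding step_pmf_def by (simp only: recent_profiles_restrict)
    then show ?thesis by simp
  qed
  finally show ?thesis .
qed

section \<open>The Markov operator on nodes and the series for the value\<close>

definition transition_op ::
  "('i \<Rightarrow> ('i, 's, 'x) strategy) \<Rightarrow> ('x \<times> ('i \<Rightarrow> 's) list \<Rightarrow> real)
     \<Rightarrow> 'x \<times> ('i \<Rightarrow> 's) list \<Rightarrow> real" where
  "transition_op \<pi> f z = (\<Sum>s\<in>profiles G. profile_prob \<pi> z s *
     (\<Sum>y\<in>states G. pmf (trans G (fst z) s) y * f (succ_node z s y)))"

definition stage_payoff ::
  "'i \<Rightarrow> ('i \<Rightarrow> ('i, 's, 'x) strategy) \<Rightarrow> 'x \<times> ('i \<Rightarrow> 's) list \<Rightarrow> real" where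
  "stage_payoff i \<pi> z = (\<Sum>s\<in>profiles G. profile_prob \<pi> z s * payoff G i (fst z) s)"

lemma bellman_eq: "bellman i \<pi> v z = stage_payoff i \<pi> z + discount G i * transition_op \<pi> v z"
  unfolding bellman_def stage_payoff_def transition_op_def look_ahead_def
  by (simp add: algebra_simps sum.distrib sum_distrib_left)

context
  fixes \<pi> x h
  assumes \<pi>: "\<pi> \<in> joint_strategies k G" and x: "x \<in> states G" and h: "h \<in> histories k G"
begin

lemma space_play_measure: "space (play_measure G \<pi> x h) = PiE UNIV (\<lambda>_. states G \<times> profiles G)"
  using sets_eq_imp_space_eq[OF sets_play_measure[OF game finite_actions \<pi> x h]]
  by (simp add: space_PiM stage_space_def)

text \<open>An entry of the play pairs a state with the action taken there, while the node at time
  \<open>n\<close> is fixed before that action. Hence the state is averaged with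
  \<open>state_pmf\<close>, given the earlier entries. In the induction \<open>f\<close> must vary,
  because conditioning on the last step replaces it by \<open>transition_op \<pi> f\<close>.\<close>

lemma expectation_node:
  "(\<integral>\<omega>. (\<Sum>y\<in>states G. pmf (state_pmf G x n \<omega>) y * f (y, recent_profiles h n \<omega>)) \<partial>play_measure G \<pi> x h) =
    (transition_op \<pi> ^^ n) f (x, h)"
proof (induction n arbitrary: f)
  case 0
  interpret prob_space "play_measure G \<pi> x h"
    by (rule prob_space_play_measure[OF game finite_actions \<pi> x h])
  have "(\<Sum>y\<in>states G. pmf (return_pmf x) y * f (y, h)) = f (x, h)"
    using x finite_states by (simp add: pmf_return indicator_def sum.delta' if_distrib cong: if_cong)
  then show ?case by (simp add: state_pmf_def recent_profiles_def prob_space)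
next
  case (Suc n)
  \<comment> \<open>\<open>\<phi> \<eta> e\<close> is the conditional expectation of
    \<open>f\<close> at the node of time \<open>Suc n\<close>, given the prefix
    \<open>\<eta>\<close> and the entry \<open>e\<close> at time \<open>n\<close>.\<close>
  define \<phi> where "\<phi> \<eta> e = (\<Sum>y\<in>states G. pmf (trans G (fst e) (snd e)) y *
    f (y, take k (snd e # recent_profiles h n \<eta>)))"
    for \<eta> :: "nat \<Rightarrow> 'x \<times> ('i \<Rightarrow> 's)" and e
  have "length h = k" using h by (simp add: histories_def)
  then have "(\<integral>\<omega>. (\<Sum>y\<in>states G. pmf (state_pmf G x (Suc n) \<omega>) y * f (y, recent_profiles h (Suc n) \<omega>)) \<partial>play_measure G \<pi> x h)
      = (\<integral>\<omega>. \<phi> (restrict \<omega> {0..<n}) (\<omega> n) \<partial>play_measure G \<pi> x h)"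
    by (simp add: state_pmf_def \<phi>_def recent_profiles_restrict recent_profiles_Suc)
  also have "\<dots> = (\<integral>\<omega>. measure_pmf.expectation (step_pmf G \<pi> x h n \<omega>) (\<phi> (restrict \<omega> {0..<n})) \<partial>play_measure G \<pi> x h)"
    by (rule integral_play_step[OF \<pi> x h])
  also have "\<dots> = (\<integral>\<omega>. (\<Sum>y\<in>states G. pmf (state_pmf G x n \<omega>) y * transition_op \<pi> f (y, recent_profiles h n \<omega>)) \<partial>play_measure G \<pi> x h)"
  proof (intro Bochner_Integration.integral_cong refl)
    fix \<omega> assume "\<omega> \<in> space (play_measure G \<pi> x h)"
    then have "\<omega> m \<in> states G \<times> profiles G" for m by (auto simp: space_play_measure)
    then show "measure_pmf.expectation (step_pmf G \<pi> x h n \<omega>) (\<phi> (restrict \<omega> {0..<n})) =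
        (\<Sum>y\<in>states G. pmf (state_pmf G x n \<omega>) y * transition_op \<pi> f (y, recent_profiles h n \<omega>))"
      by (subst expectation_step[OF \<pi> x h])
         (auto simp: \<phi>_def transition_op_def recent_profiles_restrict)
  qed
  \<comment> \<open>The induction hypothesis leaves the new operator innermost;
    \<open>funpow_swap1\<close> moves it to the outside.\<close>
  also have "\<dots> = (transition_op \<pi> ^^ Suc n) f (x, h)"
    by (simp add: Suc.IH funpow_swap1)
  finally show ?case .
qed

lemma expectation_payoff:
  "(\<integral>\<omega>. payoff G i (fst (\<omega> n)) (snd (\<omega> n)) \<partial>play_measure G \<pi> x h) =
    (transition_op \<pi> ^^ n) (stage_payoff i \<pi>) (x, h)"
proof -
  have "(\<integral>\<omega>. payoff G i (fst (\<omega> n)) (snd (\<omega> n)) \<partial>play_measure G \<pi> x h) =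
     (\<integral>\<omega>. measure_pmf.expectation (step_pmf G \<pi> x h n \<omega>) (\<lambda>e. payoff G i (fst e) (snd e)) \<partial>play_measure G \<pi> x h)"
    by (rule integral_play_step[OF \<pi> x h])
  also have "\<dots> = (\<integral>\<omega>. (\<Sum>y\<in>states G. pmf (state_pmf G x n \<omega>) y * stage_payoff i \<pi> (y, recent_profiles h n \<omega>)) \<partial>play_measure G \<pi> x h)"
  proof (intro Bochner_Integration.integral_cong refl)
    fix \<omega> assume "\<omega> \<in> space (play_measure G \<pi> x h)"
    then have "\<omega> m \<in> states G \<times> profiles G" for m by (auto simp: space_play_measure)
    then show "measure_pmf.expectation (step_pmf G \<pi> x h n \<omega>) (\<lambda>e. payoff G i (fst e) (snd e)) =
        (\<Sum>y\<in>states G. pmf (state_pmf G x n \<omega>) y * stage_payoff i \<pi> (y, recent_profiles h n \<omega>))"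
      by (subst expectation_step[OF \<pi> x h]) (auto simp: stage_payoff_def)
  qed
  finally show ?thesis by (simp only: expectation_node)
qed

end

lemma payoff_bounded:
  obtains B where "\<And>y s. y \<in> states G \<Longrightarrow> s \<in> profiles G \<Longrightarrow> \<bar>payoff G i y s\<bar> \<le> B"
proof -
  have "finite ((\<lambda>(y, s). \<bar>payoff G i y s\<bar>) ` (states G \<times> profiles G))"
    using finite_states finite_profiles' by simp
  then have "\<bar>payoff G i y s\<bar> \<le> Max ((\<lambda>(y, s). \<bar>payoff G i y s\<bar>) ` (states G \<times> profiles G))"
    if "y \<in> states G" "s \<in> profiles G" for y s
    by (rule Max_ge) (use that in force)
  then show thesis by (rule that)
qed

text \<open>Payoffs are bounded, so a geometric series dominates the discounted sum and the integral
  may be taken term by term. From here on values are series on nodes and the play measure no longer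
  appears.\<close>

lemma val_sums:
  assumes i: "i \<in> players G" and \<pi>: "\<pi> \<in> joint_strategies k G" and z: "z \<in> nodes"
  shows "(\<lambda>t. discount G i ^ t * (transition_op \<pi> ^^ t) (stage_payoff i \<pi>) z) sums val i \<pi> z"
proof -
  obtain x h where [simp]: "z = (x, h)" by force
  have x: "x \<in> states G" and h: "h \<in> histories k G" using z by auto
  let ?P = "play_measure G \<pi> x h"
  interpret prob_space ?P by (rule prob_space_play_measure[OF game finite_actions \<pi> x h])
  obtain B where B: "\<And>y s. y \<in> states G \<Longrightarrow> s \<in> profiles G \<Longrightarrow> \<bar>payoff G i y s\<bar> \<le> B"
    using payoff_bounded by blast
  let ?f = "\<lambda>t \<omega>. discount G i ^ t * payoff G i (fst (\<omega> t)) (snd (\<omega> t))"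
  have bound: "norm (?f t \<omega>) \<le> discount G i ^ t * B" if "\<omega> \<in> space ?P" for t \<omega>
  proof -
    have "\<omega> t \<in> states G \<times> profiles G"
      using that unfolding space_play_measure[OF \<pi> x h] by auto
    then show ?thesis using B[of "fst (\<omega> t)" "snd (\<omega> t)"] discount[OF i]
      by (auto simp: abs_mult mem_Times_iff intro!: mult_left_mono)
  qed
  have summ: "summable (\<lambda>t. discount G i ^ t * B)"
    using discount[OF i] by (intro summable_mult2 summable_geometric) auto
  have "(\<lambda>\<omega>. \<omega> t) \<in> ?P \<rightarrow>\<^sub>M count_space (states G \<times> profiles G)" for t
    unfolding measurable_cong_sets[OF sets_play_measure[OF game finite_actions \<pi> x h] refl]
    using measurable_component_singleton[of t UNIV "stage_space G"] by (simp add: stage_space_def)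
  then have "(\<lambda>\<omega>. case \<omega> t of (y, s) \<Rightarrow> payoff G i y s) \<in> borel_measurable ?P" for t
    by (rule measurable_compose) simp
  then have [measurable]: "?f t \<in> borel_measurable ?P" for t
    by (simp add: case_prod_beta)
  have int: "integrable ?P (?f t)" for t
    by (rule integrable_const_bound[of _ "discount G i ^ t * B"]) (use bound in auto)
  have "(\<lambda>t. \<integral>\<omega>. ?f t \<omega> \<partial>?P) sums (\<integral>\<omega>. (\<Sum>t. ?f t \<omega>) \<partial>?P)"
  proof (rule sums_integral[OF int])
    show "AE \<omega> in ?P. summable (\<lambda>t. norm (?f t \<omega>))"
      by (intro AE_I2 summable_comparison_test[OF _ summ]) (use bound in auto)
    show "summable (\<lambda>t. \<integral>\<omega>. norm (?f t \<omega>) \<partial>?P)"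
    proof (rule summable_comparison_test[OF _ summ], intro exI allI impI)
      fix t :: nat
      have "(\<integral>\<omega>. norm (?f t \<omega>) \<partial>?P) \<le> (\<integral>\<omega>. discount G i ^ t * B \<partial>?P)"
        by (intro integral_mono integrable_norm int) (use bound in auto)
      then show "norm (\<integral>\<omega>. norm (?f t \<omega>) \<partial>?P) \<le> discount G i ^ t * B"
        by (simp add: prob_space)
    qed
  qed
  then show ?thesis by (simp add: game_value_def expectation_payoff[OF \<pi> x h])
qed

text \<open>Shifting the series of \<open>val_sums\<close> by one time step pulls out one factor
  \<open>discount G i\<close> and one \<open>transition_op\<close>; the removed term at time 0 is
  the stage payoff.\<close>

lemma val_bellman:
  assumes i: "i \<in> players G" and \<pi>: "\<pi> \<in> joint_strategies k G" and z: "z \<in> nodes"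
  shows "val i \<pi> z = bellman i \<pi> (val i \<pi>) z"
proof -
  let ?a = "\<lambda>t z. discount G i ^ t * (transition_op \<pi> ^^ t) (stage_payoff i \<pi>) z"
  have "(\<lambda>t. \<Sum>s\<in>profiles G. profile_prob \<pi> z s *
     (\<Sum>y\<in>states G. pmf (trans G (fst z) s) y * ?a t (succ_node z s y))) sums transition_op \<pi> (val i \<pi>) z"
    unfolding transition_op_def[of \<pi> "val i \<pi>"]
    by (intro sums_sum sums_mult val_sums[OF i \<pi> succ_node_in_nodes[OF z]])
  from sums_mult[OF this, of "discount G i"]
  have "(\<lambda>t. ?a (Suc t) z) sums (discount G i * transition_op \<pi> (val i \<pi>) z)"
    by (simp add: transition_op_def[of \<pi> "(transition_op \<pi> ^^ _) _"] sum_distrib_left mult_ac)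
  moreover have "(\<lambda>t. ?a (Suc t) z) sums (val i \<pi> z - ?a 0 z)"
    using val_sums[OF i \<pi> z] by (subst sums_Suc_iff) simp
  ultimately have "discount G i * transition_op \<pi> (val i \<pi>) z = val i \<pi> z - ?a 0 z"
    by (rule sums_unique2)
  then show ?thesis by (simp add: bellman_eq)
qed

section \<open>The one-shot deviation principle and continuity of values\<close>

text \<open>Monotonicity and contraction in one: averaging preserves a one-sided bound
  \<open>m\<close> of either sign, and discounting scales it.\<close>

lemma bellman_diff_le:
  assumes i: "i \<in> players G" and \<pi>: "\<pi> \<in> joint_strategies k G" and z: "z \<in> nodes"
    and le: "\<forall>w\<in>nodes. v w - u w \<le> m"
  shows "bellman i \<pi> v z - bellman i \<pi> u z \<le> discount G i * m"
proof -
  have "look_ahead i v z s - look_ahead i u z s \<le> discount G i * m" if s: "s \<in> profiles G" for s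
  proof -
    have "(\<Sum>y\<in>states G. pmf (trans G (fst z) s) y * (v (succ_node z s y) - u (succ_node z s y)))
        \<le> (\<Sum>y\<in>states G. pmf (trans G (fst z) s) y * m)"
      using le succ_node_in_nodes[OF z s] by (intro sum_mono mult_left_mono) simp_all
    also have "\<dots> = m"
      using z s by (simp add: sum_distrib_right[symmetric] sum_trans mem_Times_iff)
    finally have "discount G i * (\<Sum>y\<in>states G. pmf (trans G (fst z) s) y * (v (succ_node z s y) - u (succ_node z s y)))
        \<le> discount G i * m"
      by (intro mult_left_mono discount i)
    then show ?thesis by (simp add: look_ahead_def right_diff_distrib sum_subtractf)
  qed
  then have "(\<Sum>s\<in>profiles G. profile_prob \<pi> z s * (look_ahead i v z s - look_ahead i u z s))
      \<le> (\<Sum>s\<in>profiles G. profile_prob \<pi> z s * (discount G i * m))"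
    by (intro sum_mono mult_left_mono profile_prob_nonneg)
  also have "\<dots> = discount G i * m"
    by (simp add: sum_distrib_right[symmetric] sum_profile_prob[OF \<pi> z])
  finally show ?thesis by (simp add: bellman_def right_diff_distrib sum_subtractf)
qed

text \<open>At a node where \<open>v - u\<close> attains its maximum D, one Bellman step gives D
  \<le> e + e' + discount * D. Thus an approximate subsolution lies below an approximate
  supersolution up to the stated error; exact values qualify as either with error 0.\<close>

lemma bellman_comparison:
  assumes i: "i \<in> players G" and \<pi>: "\<pi> \<in> joint_strategies k G" and z: "z \<in> nodes"
    and v: "\<forall>w\<in>nodes. v w \<le> bellman i \<pi> v w + e"
    and u: "\<forall>w\<in>nodes. bellman i \<pi> u w \<le> u w + e'"
  shows "v z - u z \<le> (e + e') / (1 - discount G i)"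
proof -
  let ?D = "(\<lambda>w. v w - u w) ` nodes"
  have "finite ?D" "?D \<noteq> {}" using finite_nodes z by auto
  then have "Max ?D \<in> ?D" and le: "\<forall>w\<in>nodes. v w - u w \<le> Max ?D" by auto
  then obtain w where w: "w \<in> nodes" "v w - u w = Max ?D" by force
  have "Max ?D \<le> e + e' + discount G i * Max ?D"
    using bellman_diff_le[OF i \<pi> w(1) le] bspec[OF v w(1)] bspec[OF u w(1)] w(2) by linarith
  then have "Max ?D \<le> (e + e') / (1 - discount G i)"
    using discount[OF i] by (simp add: pos_le_divide_eq algebra_simps)
  with bspec[OF le z] show ?thesis by linarith
qed

text \<open>Summing over full profiles with an indicator for the action of \<open>i\<close> keeps
  \<open>\<pi> i\<close> out of the formula. For fixed \<open>v\<close> a deviation by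
  \<open>i\<close> therefore changes only the weights in
  \<open>bellman_action_value\<close>.\<close>

definition action_value ::
  "'i \<Rightarrow> ('i \<Rightarrow> ('i, 's, 'x) strategy) \<Rightarrow> ('x \<times> ('i \<Rightarrow> 's) list \<Rightarrow> real)
     \<Rightarrow> 'x \<times> ('i \<Rightarrow> 's) list \<Rightarrow> 's \<Rightarrow> real" where
  "action_value i \<pi> v z a = (\<Sum>s\<in>profiles G.
     of_bool (s i = a) * (\<Prod>j\<in>players G - {i}. pmf (\<pi> j z) (s j)) * look_ahead i v z s)"

lemma bellman_action_value:
  assumes i: "i \<in> players G"
  shows "bellman i \<pi> v z = (\<Sum>a\<in>actions G i. pmf (\<pi> i z) a * action_value i \<pi> v z a)"
proof -
  have fin: "finite (actions G i)" using finite_actions i by blast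
  have prob: "profile_prob \<pi> z s = (\<Sum>a\<in>actions G i. pmf (\<pi> i z) a *
      (of_bool (s i = a) * (\<Prod>j\<in>players G - {i}. pmf (\<pi> j z) (s j))))" if "s \<in> profiles G" for s
  proof -
    have "s i \<in> actions G i" using that i by (auto simp: profiles_def)
    then have "(\<Sum>a\<in>actions G i. pmf (\<pi> i z) a *
        (of_bool (s i = a) * (\<Prod>j\<in>players G - {i}. pmf (\<pi> j z) (s j))))
      = pmf (\<pi> i z) (s i) * (\<Prod>j\<in>players G - {i}. pmf (\<pi> j z) (s j))"
      using fin by (subst sum.remove[of _ "s i"]) (auto intro!: sum.neutral)
    then show ?thesis
      unfolding profile_prob_def by (simp add: prod.remove[OF finite_players i])
  qed
  have "bellman i \<pi> v z = (\<Sum>s\<in>profiles G. \<Sum>a\<in>actions G i. pmf (\<pi> i z) a *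
      (of_bool (s i = a) * (\<Prod>j\<in>players G - {i}. pmf (\<pi> j z) (s j)) * look_ahead i v z s))"
    unfolding bellman_def by (intro sum.cong refl) (simp add: prob sum_distrib_right mult.assoc)
  also have "\<dots> = (\<Sum>a\<in>actions G i. pmf (\<pi> i z) a * action_value i \<pi> v z a)"
    unfolding action_value_def sum_distrib_left by (rule sum.swap)
  finally show ?thesis .
qed

lemma action_value_fun_upd: "action_value i (\<pi>(i := \<tau>)) = action_value i \<pi>"
  by (intro ext) (simp add: action_value_def)

lemma sum_strategy:
  assumes "\<pi> \<in> joint_strategies k G" "i \<in> players G" "z \<in> nodes"
  shows "(\<Sum>a\<in>actions G i. pmf (\<pi> i z) a) = 1"
  using finite_actions assms(2) by (intro sum_pmf_eq_1 set_strategy[OF assms]) blast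

lemma joint_strategies_upd:
  "\<pi> \<in> joint_strategies k G \<Longrightarrow> i \<in> players G \<Longrightarrow> \<tau> \<in> mixed_strategies k G i \<Longrightarrow>
     \<pi>(i := \<tau>) \<in> joint_strategies k G"
  unfolding joint_strategies_def by (auto simp: PiE_iff extensional_def)

text \<open>One-shot deviation principle: improving a single action at a single node already raises the
  value there, so no optimal stationary strategy has to be constructed.\<close>

lemma best_response_iff:
  assumes i: "i \<in> players G" and \<pi>: "\<pi> \<in> joint_strategies k G"
  shows "best_response k G \<pi> i \<longleftrightarrow>
    (\<forall>z\<in>nodes. \<forall>a\<in>actions G i. action_value i \<pi> (val i \<pi>) z a \<le> val i \<pi> z)" (is "_ \<longleftrightarrow> ?R")
proof
  assume opt: ?R
  have le: "val i (\<pi>(i := \<tau>)) z \<le> val i \<pi> z" if \<tau>: "\<tau> \<in> mixed_strategies k G i" and z: "z \<in> nodes" for \<tau> z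
  proof -
    let ?\<pi> = "\<pi>(i := \<tau>)"
    have \<pi>': "?\<pi> \<in> joint_strategies k G" by (rule joint_strategies_upd[OF \<pi> i \<tau>])
    \<comment> \<open>The old value is a supersolution for every deviation, so comparison bounds the
      value of the deviation.\<close>
    have "\<forall>w\<in>nodes. bellman i ?\<pi> (val i \<pi>) w \<le> val i \<pi> w + 0"
    proof
      fix w assume w: "w \<in> nodes"
      have "bellman i ?\<pi> (val i \<pi>) w \<le> (\<Sum>a\<in>actions G i. pmf (?\<pi> i w) a * val i \<pi> w)"
        unfolding bellman_action_value[OF i] action_value_fun_upd
        using opt w by (intro sum_mono mult_left_mono) auto
      also have "\<dots> = val i \<pi> w"
        by (simp only: sum_distrib_right[symmetric] sum_strategy[OF \<pi>' i w] mult_1)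
      finally show "bellman i ?\<pi> (val i \<pi>) w \<le> val i \<pi> w + 0" by simp
    qed
    from bellman_comparison[OF i \<pi>' z _ this, of "val i ?\<pi>" 0] val_bellman[OF i \<pi>']
    show ?thesis by simp
  qed
  have "\<pi> i \<in> mixed_strategies k G i"
    using \<pi> i unfolding joint_strategies_def by (rule PiE_mem)
  then show "best_response k G \<pi> i"
    unfolding best_response_def using le
    by (intro ballI cSup_eq_maximum[symmetric]) (auto intro!: image_eqI[of _ _ "\<pi> i"])
next
  assume br: "best_response k G \<pi> i"
  show ?R
  proof (intro ballI, rule ccontr)
    fix z a assume z: "z \<in> nodes" and a: "a \<in> actions G i"
      and "\<not> action_value i \<pi> (val i \<pi>) z a \<le> val i \<pi> z"
    then have gt: "val i \<pi> z < action_value i \<pi> (val i \<pi>) z a" by simp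
    \<comment> \<open>The deviation plays the improving action \<open>a\<close> at \<open>z\<close>
      and copies \<open>\<pi> i\<close> at all other nodes.\<close>
    define \<tau> where "\<tau> = (\<pi> i)(z := return_pmf a)"
    let ?\<pi> = "\<pi>(i := \<tau>)"
    have "\<pi> i \<in> mixed_strategies k G i"
      using \<pi> i unfolding joint_strategies_def by (rule PiE_mem)
    then have \<tau>: "\<tau> \<in> mixed_strategies k G i"
      using z a unfolding mixed_strategies_def \<tau>_def by (auto simp: PiE_iff extensional_def)
    have \<pi>': "?\<pi> \<in> joint_strategies k G" by (rule joint_strategies_upd[OF \<pi> i \<tau>])
    have fin: "finite (actions G i)" using finite_actions i by blast
    have at_z: "bellman i ?\<pi> (val i \<pi>) z = action_value i \<pi> (val i \<pi>) z a"
      unfolding bellman_action_value[OF i] action_value_fun_upd using a fin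
      by (subst sum.remove[of _ a]) (auto simp: \<tau>_def intro!: sum.neutral)
    have off_z: "bellman i ?\<pi> (val i \<pi>) w = val i \<pi> w" if "w \<in> nodes" "w \<noteq> z" for w
      unfolding val_bellman[OF i \<pi> that(1)] bellman_action_value[OF i] action_value_fun_upd
      using that(2) by (simp add: \<tau>_def)
    \<comment> \<open>The old value is a subsolution for the deviation, which is therefore nowhere
      worse; one further Bellman step at \<open>z\<close> makes the improvement strict
      there.\<close>
    have sub: "\<forall>w\<in>nodes. val i \<pi> w \<le> bellman i ?\<pi> (val i \<pi>) w + 0"
    proof (intro ballI)
      fix w assume "w \<in> nodes"
      then show "val i \<pi> w \<le> bellman i ?\<pi> (val i \<pi>) w + 0"
        using off_z gt at_z by (cases "w = z") simp_all
    qed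
    have "\<forall>w\<in>nodes. val i \<pi> w - val i ?\<pi> w \<le> 0"
    proof
      fix w assume "w \<in> nodes"
      from bellman_comparison[OF i \<pi>' this sub, of "val i ?\<pi>" 0] val_bellman[OF i \<pi>']
      show "val i \<pi> w - val i ?\<pi> w \<le> 0" by simp
    qed
    from bellman_diff_le[OF i \<pi>' z this] have "val i \<pi> z < val i ?\<pi> z"
      using gt at_z val_bellman[OF i \<pi>' z] by simp
    moreover have "val i ?\<pi> z \<le> (SUP \<tau>\<in>mixed_strategies k G i. val i (\<pi>(i := \<tau>)) z)"
    proof (rule cSUP_upper[OF \<tau>])
      \<comment> \<open>A real supremum is an upper bound only for a set that is bounded above, so
        the uniform bound on values is needed here.\<close>
      obtain B where B: "\<And>y s. y \<in> states G \<Longrightarrow> s \<in> profiles G \<Longrightarrow> \<bar>payoff G i y s\<bar> \<le> B"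
        using payoff_bounded by blast
      show "bdd_above ((\<lambda>\<tau>. val i (\<pi>(i := \<tau>)) z) ` mixed_strategies k G i)"
      proof (rule bdd_aboveI2)
        fix \<tau> assume "\<tau> \<in> mixed_strategies k G i"
        then have "\<bar>val i (\<pi>(i := \<tau>)) z\<bar> \<le> B / (1 - discount G i)"
          by (intro abs_game_value_le[OF game finite_actions i])
            (use B z joint_strategies_upd[OF \<pi> i] in auto)
        then show "val i (\<pi>(i := \<tau>)) z \<le> B / (1 - discount G i)" by simp
      qed
    qed
    moreover have "val i \<pi> z = (SUP \<tau>\<in>mixed_strategies k G i. val i (\<pi>(i := \<tau>)) z)"
      using br z by (auto simp: best_response_def)
    ultimately show False by simp
  qed
qed

text \<open>With a general filter the same continuity lemmas serve sequences, for Brouwer's theorem,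
  and one-sided limits along segments.\<close>

definition strategies_tendsto ::
  "('t \<Rightarrow> 'i \<Rightarrow> ('i, 's, 'x) strategy) \<Rightarrow> ('i \<Rightarrow> ('i, 's, 'x) strategy) \<Rightarrow> 't filter \<Rightarrow> bool" where
  "strategies_tendsto \<Psi> \<pi> F \<longleftrightarrow> \<pi> \<in> joint_strategies k G \<and> (\<forall>\<^sub>F t in F. \<Psi> t \<in> joint_strategies k G) \<and>
     (\<forall>i\<in>players G. \<forall>z\<in>nodes. \<forall>a\<in>actions G i. ((\<lambda>t. pmf (\<Psi> t i z) a) \<longlongrightarrow> pmf (\<pi> i z) a) F)"

lemma pmf_strategies_tendsto:
  assumes "strategies_tendsto \<Psi> \<pi> F" "j \<in> players G" "z \<in> nodes" "s \<in> profiles G"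
  shows "((\<lambda>t. pmf (\<Psi> t j z) (s j)) \<longlongrightarrow> pmf (\<pi> j z) (s j)) F"
proof -
  have "s j \<in> actions G j" using assms(2,4) by (auto simp: profiles_def)
  with assms show ?thesis unfolding strategies_tendsto_def by blast
qed

text \<open>The limit value is almost a fixed point of the nearby operator
  \<open>bellman i (\<Psi> t)\<close>: applied to the fixed function \<open>val i \<pi>\<close>, the
  operator is polynomial in the finitely many probabilities. \<open>bellman_comparison\<close>, used
  in both directions, turns the residual into a bound on the difference of the values.\<close>

lemma val_tendsto:
  assumes lim: "strategies_tendsto \<Psi> \<pi> F" and i: "i \<in> players G" and z: "z \<in> nodes"
  shows "((\<lambda>t. val i (\<Psi> t) z) \<longlongrightarrow> val i \<pi> z) F"
proof -
  have \<pi>: "\<pi> \<in> joint_strategies k G" using lim by (simp add: strategies_tendsto_def)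
  let ?g = "\<lambda>w t. \<bar>bellman i (\<Psi> t) (val i \<pi>) w - val i \<pi> w\<bar>"
  have lim_b: "((\<lambda>t. bellman i (\<Psi> t) (val i \<pi>) w) \<longlongrightarrow> bellman i \<pi> (val i \<pi>) w) F" if w: "w \<in> nodes" for w
    unfolding bellman_def profile_prob_def
    by (intro tendsto_intros pmf_strategies_tendsto[OF lim _ w])
  have "(?g w \<longlongrightarrow> 0) F" if "w \<in> nodes" for w
    by (rule tendsto_rabs_zero[OF LIM_zero[OF lim_b[OF that, folded val_bellman[OF i \<pi> that]]]])
  then have "((\<lambda>t. (\<Sum>w\<in>nodes. ?g w t) / (1 - discount G i)) \<longlongrightarrow> (\<Sum>w\<in>nodes. 0) / (1 - discount G i)) F"
    using discount[OF i] by (intro tendsto_divide tendsto_sum tendsto_const) auto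
  then have to0: "((\<lambda>t. (\<Sum>w\<in>nodes. ?g w t) / (1 - discount G i)) \<longlongrightarrow> 0) F" by simp
  have "\<bar>val i (\<Psi> t) z - val i \<pi> z\<bar> \<le> (\<Sum>w\<in>nodes. ?g w t) / (1 - discount G i)"
    if t: "\<Psi> t \<in> joint_strategies k G" for t
  proof -
    \<comment> \<open>The sum over nodes is one error bound valid at every node, and it still tends
      to 0.\<close>
    have g: "?g w t \<le> (\<Sum>w\<in>nodes. ?g w t)" if "w \<in> nodes" for w
      by (rule member_le_sum[OF that]) (use finite_nodes in auto)
    have "val i (\<Psi> t) z - val i \<pi> z \<le> (0 + (\<Sum>w\<in>nodes. ?g w t)) / (1 - discount G i)"
    proof (rule bellman_comparison[OF i t z])
      show "\<forall>w\<in>nodes. val i (\<Psi> t) w \<le> bellman i (\<Psi> t) (val i (\<Psi> t)) w + 0"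
        using val_bellman[OF i t] by simp
      show "\<forall>w\<in>nodes. bellman i (\<Psi> t) (val i \<pi>) w \<le> val i \<pi> w + (\<Sum>w\<in>nodes. ?g w t)"
        by (intro ballI, drule g) linarith
    qed
    moreover have "val i \<pi> z - val i (\<Psi> t) z \<le> ((\<Sum>w\<in>nodes. ?g w t) + 0) / (1 - discount G i)"
    proof (rule bellman_comparison[OF i t z])
      show "\<forall>w\<in>nodes. bellman i (\<Psi> t) (val i (\<Psi> t)) w \<le> val i (\<Psi> t) w + 0"
        using val_bellman[OF i t] by simp
      show "\<forall>w\<in>nodes. val i \<pi> w \<le> bellman i (\<Psi> t) (val i \<pi>) w + (\<Sum>w\<in>nodes. ?g w t)"
        by (intro ballI, drule g) linarith
    qed
    ultimately show ?thesis by simp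
  qed
  then have "\<forall>\<^sub>F t in F. norm (val i (\<Psi> t) z - val i \<pi> z) \<le> (\<Sum>w\<in>nodes. ?g w t) / (1 - discount G i)"
    using lim by (auto simp: strategies_tendsto_def elim: eventually_mono)
  from Lim_null_comparison[OF this to0] show ?thesis by (rule LIM_zero_cancel)
qed

lemma action_value_tendsto:
  assumes lim: "strategies_tendsto \<Psi> \<pi> F" and i: "i \<in> players G" and z: "z \<in> nodes"
  shows "((\<lambda>t. action_value i (\<Psi> t) (val i (\<Psi> t)) z a) \<longlongrightarrow> action_value i \<pi> (val i \<pi>) z a) F"
proof -
  have "((\<lambda>t. val i (\<Psi> t) (succ_node z s y)) \<longlongrightarrow> val i \<pi> (succ_node z s y)) F"
    if "s \<in> profiles G" "y \<in> states G" for s y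
    by (rule val_tendsto[OF lim i succ_node_in_nodes[OF z that]])
  moreover have "((\<lambda>t. pmf (\<Psi> t j z) (s j)) \<longlongrightarrow> pmf (\<pi> j z) (s j)) F"
    if "s \<in> profiles G" "j \<in> players G - {i}" for s j
    using pmf_strategies_tendsto[OF lim _ z that(1)] that(2) by blast
  ultimately show ?thesis
    unfolding action_value_def look_ahead_def
    by (intro tendsto_sum tendsto_mult tendsto_add tendsto_prod tendsto_const) auto
qed

text \<open>Being unsatisfied is witnessed by one strict inequality between an action value and the
  value, and both sides are continuous.\<close>

lemma eventually_not_best_response:
  assumes lim: "strategies_tendsto \<Psi> \<pi> F" and i: "i \<in> players G" and nbr: "\<not> best_response k G \<pi> i"
  shows "\<forall>\<^sub>F t in F. \<not> best_response k G (\<Psi> t) i"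
proof -
  have \<pi>: "\<pi> \<in> joint_strategies k G" using lim by (simp add: strategies_tendsto_def)
  obtain z a where z: "z \<in> nodes" and a: "a \<in> actions G i"
    and gt: "val i \<pi> z < action_value i \<pi> (val i \<pi>) z a"
    using nbr unfolding best_response_iff[OF i \<pi>] by fastforce
  have "((\<lambda>t. action_value i (\<Psi> t) (val i (\<Psi> t)) z a - val i (\<Psi> t) z) \<longlongrightarrow>
      action_value i \<pi> (val i \<pi>) z a - val i \<pi> z) F"
    by (intro tendsto_diff action_value_tendsto[OF lim i z] val_tendsto[OF lim i z])
  from order_tendstoD(1)[OF this, of 0] gt
  have "\<forall>\<^sub>F t in F. 0 < action_value i (\<Psi> t) (val i (\<Psi> t)) z a - val i (\<Psi> t) z" by simp
  moreover have "\<forall>\<^sub>F t in F. \<Psi> t \<in> joint_strategies k G"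
    using lim by (simp add: strategies_tendsto_def)
  ultimately show ?thesis
  proof eventually_elim
    case (elim t)
    show ?case
      unfolding best_response_iff[OF i elim(2)] using z a elim(1) by force
  qed
qed

end

section \<open>Segments of strategies\<close>

text \<open>A Bernoulli choice between \<open>p\<close> and \<open>q\<close> yields a pmf for every
  real \<open>t\<close>; \<open>t\<close> is the weight of the second argument.\<close>

definition mixture_pmf :: "real \<Rightarrow> 'a pmf \<Rightarrow> 'a pmf \<Rightarrow> 'a pmf" where
  "mixture_pmf t p q = bind_pmf (bernoulli_pmf t) (\<lambda>b. if b then q else p)"

lemma pmf_mixture:
  "t \<in> {0..1} \<Longrightarrow> pmf (mixture_pmf t p q) a = (1 - t) * pmf p a + t * pmf q a"
  unfolding mixture_pmf_def pmf_bind by (simp add: algebra_simps)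

lemma set_mixture_pmf: "set_pmf (mixture_pmf t p q) \<subseteq> set_pmf p \<union> set_pmf q"
  unfolding mixture_pmf_def by (auto split: if_splits)

context finite_stochastic_game
begin

definition mixture ::
  "('i \<Rightarrow> ('i, 's, 'x) strategy) \<Rightarrow> ('i \<Rightarrow> ('i, 's, 'x) strategy) \<Rightarrow> real
     \<Rightarrow> 'i \<Rightarrow> ('i, 's, 'x) strategy" where
  "mixture \<pi> \<rho> t = (\<lambda>i\<in>players G. \<lambda>z\<in>nodes. mixture_pmf t (\<pi> i z) (\<rho> i z))"

lemma joint_strategiesI:
  assumes "\<pi> \<in> extensional (players G)" "\<And>i. i \<in> players G \<Longrightarrow> \<pi> i \<in> extensional nodes"
    and "\<And>i z. i \<in> players G \<Longrightarrow> z \<in> nodes \<Longrightarrow> set_pmf (\<pi> i z) \<subseteq> actions G i"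
  shows "\<pi> \<in> joint_strategies k G"
  unfolding joint_strategies_def mixed_strategies_def PiE_def Pi_def using assms by blast

lemma strategy_extensional:
  assumes "\<pi> \<in> joint_strategies k G"
  shows "\<pi> \<in> extensional (players G)" "i \<in> players G \<Longrightarrow> \<pi> i \<in> extensional nodes"
  using assms unfolding joint_strategies_def mixed_strategies_def PiE_def Pi_def by blast+

lemma mixture_joint:
  assumes "\<pi> \<in> joint_strategies k G" "\<rho> \<in> joint_strategies k G"
  shows "mixture \<pi> \<rho> t \<in> joint_strategies k G"
proof (rule joint_strategiesI)
  fix i z assume "i \<in> players G" "z \<in> nodes"
  then show "set_pmf (mixture \<pi> \<rho> t i z) \<subseteq> actions G i"
    using set_strategy[OF assms(1)] set_strategy[OF assms(2)] set_mixture_pmf[of t "\<pi> i z" "\<rho> i z"]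
    by (simp add: mixture_def del: mem_Sigma_iff) blast
qed (auto simp: mixture_def)

lemma pmf_mixture_strategy:
  "t \<in> {0..1} \<Longrightarrow> i \<in> players G \<Longrightarrow> z \<in> nodes \<Longrightarrow>
     pmf (mixture \<pi> \<rho> t i z) a = (1 - t) * pmf (\<pi> i z) a + t * pmf (\<rho> i z) a"
  unfolding mixture_def by (simp add: pmf_mixture del: mem_Sigma_iff)

text \<open>Players whose strategies agree at both ends stand still on the segment, as a satisficing
  step demands. Extensionality upgrades agreement on nodes to equality of functions.\<close>

lemma mixture_same:
  assumes "\<pi> \<in> joint_strategies k G" "i \<in> players G" "\<rho> i = \<pi> i" "t \<in> {0..1}"
  shows "mixture \<pi> \<rho> t i = \<pi> i"
proof (rule extensionalityI[of _ nodes])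
  show "mixture \<pi> \<rho> t i \<in> extensional nodes" using assms(2) by (simp add: mixture_def)
  show "\<pi> i \<in> extensional nodes" by (rule strategy_extensional(2)[OF assms(1,2)])
  show "mixture \<pi> \<rho> t i z = \<pi> i z" if "z \<in> nodes" for z
    by (rule pmf_eqI) (simp only: pmf_mixture_strategy[OF assms(4,2) that] assms(3), simp add: algebra_simps)
qed

lemma mixture_1:
  assumes "\<rho> \<in> joint_strategies k G"
  shows "mixture \<pi> \<rho> 1 = \<rho>"
proof (rule extensionalityI[of _ "players G"])
  show "mixture \<pi> \<rho> 1 \<in> extensional (players G)" by (simp add: mixture_def)
  show "\<rho> \<in> extensional (players G)" by (rule strategy_extensional(1)[OF assms])
  show "mixture \<pi> \<rho> 1 i = \<rho> i" if i: "i \<in> players G" for i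
  proof (rule extensionalityI[of _ nodes])
    show "mixture \<pi> \<rho> 1 i \<in> extensional nodes" using i by (simp add: mixture_def)
    show "\<rho> i \<in> extensional nodes" by (rule strategy_extensional(2)[OF assms i])
    show "mixture \<pi> \<rho> 1 i z = \<rho> i z" if z: "z \<in> nodes" for z
      by (rule pmf_eqI) (simp add: pmf_mixture_strategy[OF _ i z])
  qed
qed

lemma eventually_unit: "\<forall>\<^sub>F t in at_right (0::real). t \<in> {0<..<1}"
  using eventually_at_right_real[of 0 "1::real"] by simp

lemma mixture_tendsto:
  assumes \<pi>: "\<pi> \<in> joint_strategies k G" and \<rho>: "\<rho> \<in> joint_strategies k G"
  shows "strategies_tendsto (mixture \<pi> \<rho>) \<pi> (at_right 0)"
  unfolding strategies_tendsto_def
proof (intro conjI ballI)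
  show "\<forall>\<^sub>F t in at_right 0. mixture \<pi> \<rho> t \<in> joint_strategies k G"
    using mixture_joint[OF \<pi> \<rho>] by simp
  fix i z a assume i: "i \<in> players G" and z: "z \<in> nodes"
  have "((\<lambda>t. (1 - t) * pmf (\<pi> i z) a + t * pmf (\<rho> i z) a) \<longlongrightarrow>
      (1 - 0) * pmf (\<pi> i z) a + 0 * pmf (\<rho> i z) a) (at_right 0)"
    by (intro tendsto_intros)
  moreover have "\<forall>\<^sub>F t in at_right 0. (1 - t) * pmf (\<pi> i z) a + t * pmf (\<rho> i z) a = pmf (mixture \<pi> \<rho> t i z) a"
    using eventually_unit by eventually_elim (simp add: pmf_mixture_strategy[OF _ i z])
  ultimately show "((\<lambda>t. pmf (mixture \<pi> \<rho> t i z) a) \<longlongrightarrow> pmf (\<pi> i z) a) (at_right 0)"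
    by (simp add: tendsto_cong)
qed (fact \<pi>)

section \<open>Rationality of values along a segment\<close>

definition transition_prob ::
  "('i \<Rightarrow> ('i, 's, 'x) strategy) \<Rightarrow> 'x \<times> ('i \<Rightarrow> 's) list \<Rightarrow> 'x \<times> ('i \<Rightarrow> 's) list \<Rightarrow> real" where
  "transition_prob \<pi> z w = transition_op \<pi> (\<lambda>w'. of_bool (w' = w)) z"

lemma transition_prob_nonneg: "0 \<le> transition_prob \<pi> z w"
  unfolding transition_prob_def transition_op_def
  by (intro sum_nonneg mult_nonneg_nonneg profile_prob_nonneg) auto

text \<open>Expanding \<open>v\<close> at the successor node in indicators of nodes and exchanging
  sums exhibits \<open>transition_prob\<close> as the matrix of the operator, which puts the Bellman
  equation into the form of a linear system.\<close>

lemma transition_op_eq: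
  assumes "z \<in> nodes"
  shows "transition_op \<pi> v z = (\<Sum>w\<in>nodes. transition_prob \<pi> z w * v w)"
proof -
  have "v (succ_node z s y) = (\<Sum>w\<in>nodes. of_bool (succ_node z s y = w) * v w)"
    if "s \<in> profiles G" "y \<in> states G" for s y
    using succ_node_in_nodes[OF assms that] finite_nodes
    by (subst sum.remove[of _ "succ_node z s y"]) (auto intro!: sum.neutral simp del: mem_Sigma_iff)
  then have "transition_op \<pi> v z = (\<Sum>s\<in>profiles G. \<Sum>y\<in>states G. \<Sum>w\<in>nodes.
      profile_prob \<pi> z s * (pmf (trans G (fst z) s) y * of_bool (succ_node z s y = w)) * v w)"
    unfolding transition_op_def by (simp add: sum_distrib_left mult.assoc)
  also have "\<dots> = (\<Sum>s\<in>profiles G. \<Sum>w\<in>nodes. \<Sum>y\<in>states G.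
      profile_prob \<pi> z s * (pmf (trans G (fst z) s) y * of_bool (succ_node z s y = w)) * v w)"
    by (intro sum.cong refl sum.swap)
  also have "\<dots> = (\<Sum>w\<in>nodes. \<Sum>s\<in>profiles G. \<Sum>y\<in>states G.
      profile_prob \<pi> z s * (pmf (trans G (fst z) s) y * of_bool (succ_node z s y = w)) * v w)"
    by (rule sum.swap)
  also have "\<dots> = (\<Sum>w\<in>nodes. transition_prob \<pi> z w * v w)"
    unfolding transition_prob_def transition_op_def
    by (simp only: sum_distrib_left sum_distrib_right)
  finally show ?thesis .
qed

lemma sum_transition_prob:
  assumes \<pi>: "\<pi> \<in> joint_strategies k G" and z: "z \<in> nodes"
  shows "(\<Sum>w\<in>nodes. transition_prob \<pi> z w) = 1"
proof -
  have "(\<Sum>w\<in>nodes. transition_prob \<pi> z w) = transition_op \<pi> (\<lambda>_. 1) z"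
    by (simp add: transition_op_eq[OF z])
  also have "\<dots> = 1"
    unfolding transition_op_def using z sum_profile_prob[OF \<pi> z] by (simp add: sum_trans mem_Times_iff)
  finally show ?thesis .
qed

context
  fixes \<pi> \<rho>
  assumes \<pi>: "\<pi> \<in> joint_strategies k G" and \<rho>: "\<rho> \<in> joint_strategies k G"
begin

lemma rational_pmf_mixture:
  assumes "i \<in> players G" "z \<in> nodes"
  shows "rational_on_unit (\<lambda>t. pmf (mixture \<pi> \<rho> t i z) a)"
proof (rule rational_on_unit_cong)
  show "rational_on_unit (\<lambda>t. (1 - t) * pmf (\<pi> i z) a + t * pmf (\<rho> i z) a)"
    by (intro rational_on_unit_add rational_on_unit_mult rational_on_unit_diff
        rational_on_unit_const rational_on_unit_ident)
qed (simp only: pmf_mixture_strategy[OF _ assms])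

lemma rational_profile_prob_mixture:
  "z \<in> nodes \<Longrightarrow> rational_on_unit (\<lambda>t. profile_prob (mixture \<pi> \<rho> t) z s)"
  unfolding profile_prob_def by (intro rational_on_unit_prod rational_pmf_mixture)

text \<open>The Bellman equation along the segment is a linear system whose coefficients are
  rational in \<open>t\<close>, nonnegative, and of row sum \<open>discount G i\<close>, so
  elimination applies.\<close>

lemma rational_val_mixture:
  assumes i: "i \<in> players G" and z: "z \<in> nodes"
  shows "rational_on_unit (\<lambda>t. val i (mixture \<pi> \<rho> t) z)"
proof (rule rational_on_unit_linear_system[OF finite_nodes discount(2)[OF i] _ _ _ _ _ z,
    where A = "\<lambda>z w t. discount G i * transition_prob (mixture \<pi> \<rho> t) z w"
      and b = "\<lambda>z t. stage_payoff i (mixture \<pi> \<rho> t) z"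
      and v = "\<lambda>z t. val i (mixture \<pi> \<rho> t) z"])
  fix z w t assume z: "z \<in> nodes"
  show "rational_on_unit (\<lambda>t. discount G i * transition_prob (mixture \<pi> \<rho> t) z w)"
    unfolding transition_prob_def transition_op_def
    by (intro rational_on_unit_mult rational_on_unit_sum rational_on_unit_const
        rational_profile_prob_mixture[OF z])
  show "rational_on_unit (\<lambda>t. stage_payoff i (mixture \<pi> \<rho> t) z)"
    unfolding stage_payoff_def
    by (intro rational_on_unit_mult rational_on_unit_sum rational_on_unit_const
        rational_profile_prob_mixture[OF z])
  show "0 \<le> discount G i * transition_prob (mixture \<pi> \<rho> t) z w"
    by (intro mult_nonneg_nonneg discount i transition_prob_nonneg)
  note mix = mixture_joint[OF \<pi> \<rho>, of t]
  show "(\<Sum>w\<in>nodes. discount G i * transition_prob (mixture \<pi> \<rho> t) z w) \<le> discount G i"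
    by (simp add: sum_distrib_left[symmetric] sum_transition_prob[OF mix z])
  show "val i (mixture \<pi> \<rho> t) z = stage_payoff i (mixture \<pi> \<rho> t) z +
      (\<Sum>w\<in>nodes. discount G i * transition_prob (mixture \<pi> \<rho> t) z w * val i (mixture \<pi> \<rho> t) w)"
    using val_bellman[OF i mix z]
    by (simp only: bellman_eq transition_op_eq[OF z] sum_distrib_left mult.assoc)
qed

lemma rational_action_value_mixture:
  assumes i: "i \<in> players G" and z: "z \<in> nodes"
  shows "rational_on_unit (\<lambda>t. action_value i (mixture \<pi> \<rho> t) (val i (mixture \<pi> \<rho> t)) z a)"
  unfolding action_value_def look_ahead_def
  by (intro rational_on_unit_mult rational_on_unit_sum rational_on_unit_const rational_on_unit_add
      rational_on_unit_prod rational_pmf_mixture rational_val_mixture[OF i] succ_node_in_nodes z) auto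

end

text \<open>The value is the average of the action values with positive weights. If none of them
  exceeds the average, all are equal to it.\<close>

lemma best_response_fully_mixed:
  assumes i: "i \<in> players G" and \<pi>: "\<pi> \<in> joint_strategies k G" and br: "best_response k G \<pi> i"
    and pos: "\<forall>z\<in>nodes. \<forall>a\<in>actions G i. 0 < pmf (\<pi> i z) a" and z: "z \<in> nodes" and a: "a \<in> actions G i"
  shows "action_value i \<pi> (val i \<pi>) z a = val i \<pi> z"
proof -
  have fin: "finite (actions G i)" using finite_actions i by blast
  have le: "\<forall>b\<in>actions G i. action_value i \<pi> (val i \<pi>) z b \<le> val i \<pi> z"
    using br z unfolding best_response_iff[OF i \<pi>] by blast
  have "(\<Sum>b\<in>actions G i. pmf (\<pi> i z) b * (val i \<pi> z - action_value i \<pi> (val i \<pi>) z b))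
      = (\<Sum>b\<in>actions G i. pmf (\<pi> i z) b) * val i \<pi> z - bellman i \<pi> (val i \<pi>) z"
    by (simp add: bellman_action_value[OF i] right_diff_distrib sum_subtractf sum_distrib_right)
  also have "\<dots> = 0"
    using val_bellman[OF i \<pi> z] by (simp add: sum_strategy[OF \<pi> i z])
  finally have "pmf (\<pi> i z) a * (val i \<pi> z - action_value i \<pi> (val i \<pi>) z a) = 0"
    using le a by (subst (asm) sum_nonneg_eq_0_iff[OF fin]) auto
  with pos z a show ?thesis by force
qed

text \<open>For a fully mixed strategy, best responding means that all action values agree with the value.
  Along a segment these are equations between rational functions of the parameter, so a violation at
  one end persists at all but finitely many points.\<close>

lemma eventually_not_best_response_mixture:
  assumes i: "i \<in> players G" and \<pi>: "\<pi> \<in> joint_strategies k G" and \<rho>: "\<rho> \<in> joint_strategies k G"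
    and nbr: "\<not> best_response k G \<rho> i"
    and pos: "\<forall>z\<in>nodes. \<forall>a\<in>actions G i. 0 < pmf (\<rho> i z) a"
  shows "\<forall>\<^sub>F t in at_right 0. \<not> best_response k G (mixture \<pi> \<rho> t) i"
proof -
  obtain z a where z: "z \<in> nodes" and a: "a \<in> actions G i"
    and gt: "val i \<rho> z < action_value i \<rho> (val i \<rho>) z a"
    using nbr unfolding best_response_iff[OF i \<rho>] by fastforce
  let ?f = "\<lambda>t. action_value i (mixture \<pi> \<rho> t) (val i (mixture \<pi> \<rho> t)) z a - val i (mixture \<pi> \<rho> t) z"
  have "rational_on_unit ?f"
    by (intro rational_on_unit_diff rational_action_value_mixture rational_val_mixture \<pi> \<rho> i z)
  moreover have "?f 1 \<noteq> 0" using gt by (simp add: mixture_1[OF \<rho>])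
  ultimately have "\<forall>\<^sub>F t in at_right 0. ?f t \<noteq> 0"
    by (rule rational_on_unit_eventually_nonzero)
  with eventually_unit show ?thesis
  proof eventually_elim
    case (elim t)
    \<comment> \<open>For \<open>t > 0\<close> full support is inherited from \<open>\<rho>\<close>
      alone; \<open>\<pi>\<close> may lie on the boundary.\<close>
    have "\<forall>z\<in>nodes. \<forall>a\<in>actions G i. 0 < pmf (mixture \<pi> \<rho> t i z) a"
    proof (intro ballI)
      fix z a assume "z \<in> nodes" "a \<in> actions G i"
      with pos elim(1) show "0 < pmf (mixture \<pi> \<rho> t i z) a"
        by (subst pmf_mixture_strategy[OF _ i]) (auto intro!: add_nonneg_pos)
    qed
    then show ?case
      using best_response_fully_mixed[OF i mixture_joint[OF \<pi> \<rho>] _ _ z a] elim(2) by auto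
  qed
qed

end

section \<open>Equilibria with frozen players\<close>

text \<open>Missing mass is spread evenly and excess mass is scaled away. The denominator is at
  least 1, so the map is continuous, and it fixes the simplex pointwise.\<close>

definition simplex_retraction :: "'a set \<Rightarrow> ('a \<Rightarrow> real) \<Rightarrow> 'a \<Rightarrow> real" where
  "simplex_retraction A q a = (q a + max 0 (1 - sum q A) / real (card A)) / max 1 (sum q A)"

lemma simplex_retraction_nonneg: "q a \<ge> 0 \<Longrightarrow> simplex_retraction A q a \<ge> 0"
  unfolding simplex_retraction_def by (intro divide_nonneg_nonneg add_nonneg_nonneg) auto

lemma sum_simplex_retraction:
  assumes "finite A" "A \<noteq> {}"
  shows "sum (simplex_retraction A q) A = 1"
proof -
  have "(\<Sum>a\<in>A. q a + max 0 (1 - sum q A) / real (card A)) = sum q A + max 0 (1 - sum q A)"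
    using assms by (simp add: sum.distrib)
  also have "\<dots> = max 1 (sum q A)" by simp
  finally show ?thesis
    unfolding simplex_retraction_def by (simp add: sum_divide_distrib[symmetric])
qed

lemma simplex_retraction_id: "sum q A = 1 \<Longrightarrow> simplex_retraction A q a = q a"
  unfolding simplex_retraction_def by simp

text \<open>\<open>embed_pmf\<close> takes a weight on the whole type, hence the value 0 off
  \<open>A\<close>.\<close>

definition weights_pmf :: "'a set \<Rightarrow> ('a \<Rightarrow> real) \<Rightarrow> 'a pmf" where
  "weights_pmf A f = embed_pmf (\<lambda>a. if a \<in> A then f a else 0)"

lemma
  assumes "finite A" "\<And>a. a \<in> A \<Longrightarrow> f a \<ge> 0" "sum f A = 1"
  shows pmf_weights: "a \<in> A \<Longrightarrow> pmf (weights_pmf A f) a = f a"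
    and set_weights_pmf: "set_pmf (weights_pmf A f) \<subseteq> A"
proof -
  let ?f = "\<lambda>a. if a \<in> A then f a else 0"
  have nn: "\<And>a. 0 \<le> ?f a" using assms(2) by simp
  have "(\<integral>\<^sup>+a. ennreal (?f a) \<partial>count_space UNIV) = (\<Sum>a\<in>A. ennreal (?f a))"
    using assms(1) by (intro nn_integral_count_space'[OF assms(1)]) auto
  also have "\<dots> = 1" using assms by (simp add: sum_ennreal)
  finally have one: "(\<integral>\<^sup>+a. ennreal (?f a) \<partial>count_space UNIV) = 1" .
  show "pmf (weights_pmf A f) a = f a" if "a \<in> A"
    using that unfolding weights_pmf_def by (simp add: pmf_embed_pmf[OF nn one])
  show "set_pmf (weights_pmf A f) \<subseteq> A"
    unfolding weights_pmf_def by (auto simp: set_embed_pmf[OF nn one] split: if_splits)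
qed

context finite_stochastic_game
begin

lemma actions_nonempty:
  "\<pi> \<in> joint_strategies k G \<Longrightarrow> i \<in> players G \<Longrightarrow> z \<in> nodes \<Longrightarrow> actions G i \<noteq> {}"
  using set_strategy set_pmf_not_empty by fastforce

lemma eventually_at_right_0_ex:
  assumes "\<forall>\<^sub>F t in at_right (0::real). P t"
  shows "\<exists>t\<in>{0<..<1}. P t"
proof -
  have "\<forall>\<^sub>F t in at_right 0. t \<in> {0<..<1} \<and> P t"
    using eventually_unit assms by (rule eventually_conj)
  from eventually_happens'[OF trivial_limit_at_right_real this] show ?thesis by blast
qed

text \<open>Nash's map on the product of the simplices of the players in \<open>U\<close>, extended to a cube by a
  retraction, the other players being frozen.\<close>

lemma exists_partial_equilibrium:
  assumes \<pi>: "\<pi> \<in> joint_strategies k G" and U: "U \<subseteq> players G"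
  shows "\<exists>\<rho>\<in>joint_strategies k G. (\<forall>i\<in>players G - U. \<rho> i = \<pi> i) \<and> (\<forall>i\<in>U. best_response k G \<rho> i)"
proof -
  \<comment> \<open>The cube has one coordinate for each player of \<open>U\<close>, node and
    action; each block with fixed player and node is retracted to a simplex and read as a mixed
    action.\<close>
  define J where "J = Sigma U (\<lambda>i. nodes \<times> actions G i)"
  define ret where "ret c i z = simplex_retraction (actions G i) (\<lambda>a. c (i, z, a))"
    for c :: "'i \<times> ('x \<times> ('i \<Rightarrow> 's) list) \<times> 's \<Rightarrow> real" and i z
  define strat where "strat c = (\<lambda>i\<in>players G. if i \<in> U then \<lambda>z\<in>nodes. weights_pmf (actions G i) (ret c i z) else \<pi> i)"
    for c
  define gain where "gain c i z a = max 0 (action_value i (strat c) (val i (strat c)) z a - val i (strat c) z)"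
    for c i z a
  define nash where "nash c = (\<lambda>(i, z, a). (pmf (strat c i z) a + gain c i z a) / (1 + (\<Sum>b\<in>actions G i. gain c i z b)))"
    for c
  have finU: "finite U" by (rule finite_subset[OF U finite_players])
  have finA: "finite (actions G i)" if "i \<in> U" for i using finite_actions U that by blast
  have finJ: "finite J" unfolding J_def
    by (rule finite_SigmaI[OF finU finite_cartesian_product[OF finite_nodes finA]])
  have gain_nonneg: "0 \<le> gain c i z a" for c i z a by (simp add: gain_def)
  have sgain_nonneg: "0 \<le> (\<Sum>b\<in>actions G i. gain c i z b)" for c i z
    by (intro sum_nonneg gain_nonneg)
  have ret: "(\<forall>a\<in>actions G i. 0 \<le> ret c i z a) \<and> sum (ret c i z) (actions G i) = 1"
    if c: "\<forall>j\<in>J. c j \<in> {0..1}" and i: "i \<in> U" and z: "z \<in> nodes" for c i z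
  proof
    show "\<forall>a\<in>actions G i. 0 \<le> ret c i z a" unfolding ret_def
      using c i z by (intro ballI simplex_retraction_nonneg) (force simp: J_def)
    show "sum (ret c i z) (actions G i) = 1" unfolding ret_def
      using actions_nonempty[OF \<pi> _ z] i U by (intro sum_simplex_retraction finA) auto
  qed
  have pmf_strat: "pmf (strat c i z) a = ret c i z a"
    if c: "\<forall>j\<in>J. c j \<in> {0..1}" and i: "i \<in> U" and z: "z \<in> nodes" and a: "a \<in> actions G i" for c i z a
  proof -
    have "strat c i z = weights_pmf (actions G i) (ret c i z)"
      using i z U by (auto simp: strat_def)
    then show ?thesis
      using pmf_weights[OF finA[OF i] _ _ a] ret[OF c i z] by simp
  qed
  have strat_same: "strat c i = \<pi> i" if "i \<in> players G - U" for c i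
    using that by (simp add: strat_def)
  have strat_joint: "strat c \<in> joint_strategies k G" if c: "\<forall>j\<in>J. c j \<in> {0..1}" for c
  proof (rule joint_strategiesI)
    show "strat c \<in> extensional (players G)" by (simp add: strat_def)
    show "strat c i \<in> extensional nodes" if "i \<in> players G" for i
      using that strategy_extensional(2)[OF \<pi> that] by (simp add: strat_def)
    fix i z assume i: "i \<in> players G" and z: "z \<in> nodes"
    show "set_pmf (strat c i z) \<subseteq> actions G i"
    proof (cases "i \<in> U")
      case True
      then have "strat c i z = weights_pmf (actions G i) (ret c i z)"
        using z i by (auto simp: strat_def)
      then show ?thesis
        using set_weights_pmf[OF finA[OF True]] ret[OF c True z] by simp
    next
      case False
      then show ?thesis using set_strategy[OF \<pi> i z] strat_same[of i c] i by simp
    qed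
  qed
  have "\<exists>c. \<forall>j\<in>J. c j \<in> {0..1} \<and> nash c j = c j"
  proof (rule brouwer_unit_cube[OF finJ])
    fix c :: "'i \<times> ('x \<times> ('i \<Rightarrow> 's) list) \<times> 's \<Rightarrow> real" and j
    assume "j \<in> J"
    then obtain i z a where j: "j = (i, z, a)" and i: "i \<in> U" and a: "a \<in> actions G i"
      by (auto simp: J_def)
    have "gain c i z a \<le> (\<Sum>b\<in>actions G i. gain c i z b)"
      by (rule member_le_sum[OF a]) (use gain_nonneg finA[OF i] in auto)
    then have "pmf (strat c i z) a + gain c i z a \<le> 1 + (\<Sum>b\<in>actions G i. gain c i z b)"
      by (intro add_mono pmf_le_1)
    then show "nash c j \<in> {0..1}"
      unfolding nash_def j using gain_nonneg[of c i z a] sgain_nonneg[of c i z]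
      by (auto intro!: divide_nonneg_nonneg add_nonneg_nonneg)
  next
    fix X and c :: "'i \<times> ('x \<times> ('i \<Rightarrow> 's) list) \<times> 's \<Rightarrow> real" and j
    assume X: "\<And>m j. j \<in> J \<Longrightarrow> X m j \<in> {0..1}" and c: "\<And>j. j \<in> J \<Longrightarrow> c j \<in> {0..1}"
      and conv: "\<And>j. j \<in> J \<Longrightarrow> (\<lambda>m. X m j) \<longlonglongrightarrow> c j" and "j \<in> J"
    from \<open>j \<in> J\<close> obtain i z a where j: "j = (i, z, a)" and i: "i \<in> U" and z: "z \<in> nodes" and a: "a \<in> actions G i"
      by (auto simp: J_def)
    have X': "\<forall>j\<in>J. X m j \<in> {0..1}" and c': "\<forall>j\<in>J. c j \<in> {0..1}" for m
      using X c by blast+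
    have iP: "i \<in> players G" using i U by blast
    have lim: "strategies_tendsto (\<lambda>m. strat (X m)) (strat c) sequentially"
      unfolding strategies_tendsto_def
    proof (intro conjI ballI)
      show "strat c \<in> joint_strategies k G" by (rule strat_joint[OF c'])
      show "\<forall>\<^sub>F m in sequentially. strat (X m) \<in> joint_strategies k G"
        using strat_joint[OF X'] by simp
      fix i z a assume iP: "i \<in> players G" and z: "z \<in> nodes" and a: "a \<in> actions G i"
      show "(\<lambda>m. pmf (strat (X m) i z) a) \<longlonglongrightarrow> pmf (strat c i z) a"
      proof (cases "i \<in> U")
        case True
        have [tendsto_intros]: "(\<lambda>m. X m (i, z, b)) \<longlonglongrightarrow> c (i, z, b)" if "b \<in> actions G i" for b
          by (rule conv) (use True z that in \<open>auto simp: J_def\<close>)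
        show ?thesis
          unfolding pmf_strat[OF X' True z a] pmf_strat[OF c' True z a] ret_def simplex_retraction_def
          using actions_nonempty[OF \<pi> iP z] finA[OF True] a
          by (intro tendsto_intros) (auto simp: max_def)
      next
        case False
        then show ?thesis using strat_same iP by simp
      qed
    qed
    have "(\<lambda>m. gain (X m) i z b) \<longlonglongrightarrow> gain c i z b" for b
      unfolding gain_def
      by (intro tendsto_intros action_value_tendsto[OF lim iP z] val_tendsto[OF lim iP z])
    moreover have "(\<lambda>m. pmf (strat (X m) i z) a) \<longlonglongrightarrow> pmf (strat c i z) a"
      using lim iP z a unfolding strategies_tendsto_def by blast
    moreover have "1 + (\<Sum>b\<in>actions G i. gain c i z b) \<noteq> 0"
      using sgain_nonneg[of c i z] by linarith
    ultimately show "(\<lambda>m. nash (X m) j) \<longlonglongrightarrow> nash c j"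
      unfolding nash_def j prod.case
      by (intro tendsto_divide tendsto_add tendsto_sum tendsto_const)
  qed
  then obtain c where c: "\<forall>j\<in>J. c j \<in> {0..1}" and fixed: "\<And>j. j \<in> J \<Longrightarrow> nash c j = c j"
    by blast
  have \<rho>: "strat c \<in> joint_strategies k G" by (rule strat_joint[OF c])
  have "best_response k G (strat c) i" if i: "i \<in> U" for i
  proof -
    have iP: "i \<in> players G" using i U by blast
    have "action_value i (strat c) (val i (strat c)) z a \<le> val i (strat c) z"
      if z: "z \<in> nodes" and a: "a \<in> actions G i" for z a
    proof -
      let ?S = "\<Sum>b\<in>actions G i. gain c i z b" and ?p = "pmf (strat c i z)"
        and ?d = "\<lambda>b. action_value i (strat c) (val i (strat c)) z b - val i (strat c) z"
      have sum_p: "sum ?p (actions G i) = 1" by (rule sum_strategy[OF \<rho> iP z])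
      have c_eq: "c (i, z, b) = (?p b + gain c i z b) / (1 + ?S)" if "b \<in> actions G i" for b
        using fixed[of "(i, z, b)"] i z that by (auto simp: J_def nash_def)
      have pos: "1 + ?S > 0" using sgain_nonneg[of c i z] by linarith
      have "(\<Sum>b\<in>actions G i. c (i, z, b)) = (\<Sum>b\<in>actions G i. ?p b + gain c i z b) / (1 + ?S)"
        by (simp add: c_eq sum_divide_distrib)
      also have "\<dots> = 1" using pos by (simp add: sum.distrib sum_p)
      \<comment> \<open>At a fixed point each block is already normalised, being in the image of
        Nash's map. The retraction leaves it alone, so the coordinates are the probabilities
        themselves.\<close>
      finally have "?p b = c (i, z, b)" if "b \<in> actions G i" for b
        using pmf_strat[OF c i z that] simplex_retraction_id[of "\<lambda>b. c (i, z, b)" "actions G i" b]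
        by (simp add: ret_def)
      then have "?p b * (1 + ?S) = ?p b + gain c i z b" if "b \<in> actions G i" for b
        using c_eq[OF that] pos that by (simp add: field_simps)
      then have gain: "gain c i z b = ?p b * ?S" if "b \<in> actions G i" for b
        using that by (simp add: algebra_simps)
      \<comment> \<open>Gains are proportional to probabilities. If \<open>?S\<close> were positive,
        every action in the support would be strictly better than the value, although the value is
        the average of the action values with these probabilities.\<close>
      have "?S = 0"
      proof (rule ccontr)
        assume "?S \<noteq> 0"
        then have S: "?S > 0" using sgain_nonneg[of c i z] by linarith
        have d: "?d b = ?p b * ?S" if "b \<in> actions G i" "?p b \<noteq> 0" for b
        proof -
          have "0 < ?p b" using that(2) by (simp add: pmf_pos)
          then have "gain c i z b > 0" using gain[OF that(1)] S by simp
          then show ?thesis using gain[OF that(1)] by (auto simp: gain_def max_def split: if_splits)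
        qed
        have "(\<Sum>b\<in>actions G i. ?p b * ?d b) = bellman i (strat c) (val i (strat c)) z - sum ?p (actions G i) * val i (strat c) z"
          by (simp add: bellman_action_value[OF iP] right_diff_distrib sum_subtractf sum_distrib_right)
        also have "\<dots> = 0" using val_bellman[OF iP \<rho> z] by (simp add: sum_p)
        finally have "(\<Sum>b\<in>actions G i. ?p b * ?d b) = 0" .
        moreover have pd: "?p b * ?d b = ?p b * (?p b * ?S)" if "b \<in> actions G i" for b
        proof (cases "?p b = 0")
          case False
          show ?thesis by (simp only: d[OF that False])
        qed simp
        ultimately have "(\<Sum>b\<in>actions G i. ?p b * (?p b * ?S)) = 0"
          by (simp only: sum.cong[OF refl pd])
        then have "\<forall>b\<in>actions G i. ?p b * (?p b * ?S) = 0"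
          using S by (subst (asm) sum_nonneg_eq_0_iff[OF finA[OF i]]) auto
        then have "sum ?p (actions G i) = 0" using S by simp
        with sum_p show False by simp
      qed
      then have "gain c i z a = 0" using gain[OF a] by simp
      then show ?thesis by (auto simp: gain_def max_def split: if_splits)
    qed
    then show ?thesis unfolding best_response_iff[OF iP \<rho>] by blast
  qed
  with \<rho> strat_same show ?thesis by blast
qed

section \<open>Satisficing paths\<close>

definition satisficing_reachable ::
  "('i \<Rightarrow> ('i, 's, 'x) strategy) \<Rightarrow> ('i \<Rightarrow> ('i, 's, 'x) strategy) \<Rightarrow> bool" where
  "satisficing_reachable \<sigma> \<pi> \<longleftrightarrow> (\<exists>T path. satisficing_path k G T path \<and> path 0 = \<sigma> \<and> path T = \<pi>)"

lemma satisficing_reachable_refl: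
  "\<sigma> \<in> joint_strategies k G \<Longrightarrow> satisficing_reachable \<sigma> \<sigma>"
  unfolding satisficing_reachable_def satisficing_path_def
  by (intro exI[of _ 0] exI[of _ "\<lambda>_. \<sigma>"]) simp

lemma satisficing_reachable_joint:
  "satisficing_reachable \<sigma> \<pi> \<Longrightarrow> \<pi> \<in> joint_strategies k G"
  unfolding satisficing_reachable_def satisficing_path_def by blast

definition unsatisfied :: "('i \<Rightarrow> ('i, 's, 'x) strategy) \<Rightarrow> 'i set" where
  "unsatisfied \<pi> = {i\<in>players G. \<not> best_response k G \<pi> i}"

lemma satisficing_reachable_step:
  assumes "satisficing_reachable \<sigma> \<pi>" "\<pi>' \<in> joint_strategies k G"
    and "\<And>i. i \<in> players G - unsatisfied \<pi> \<Longrightarrow> \<pi>' i = \<pi> i"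
  shows "satisficing_reachable \<sigma> \<pi>'"
proof -
  obtain T path where path: "satisficing_path k G T path" "path 0 = \<sigma>" "path T = \<pi>"
    using assms(1) unfolding satisficing_reachable_def by blast
  have "satisficing_path k G (Suc T) (path(Suc T := \<pi>'))"
    using path(1,3) assms(2,3) unfolding satisficing_path_def unsatisfied_def
    by (auto simp: less_Suc_eq le_Suc_eq)
  then show ?thesis
    unfolding satisficing_reachable_def using path(2)
    by (intro exI[of _ "Suc T"] exI[of _ "path(Suc T := \<pi>')"]) simp
qed

lemma exists_reachable_equilibrium:
  assumes \<sigma>: "\<sigma> \<in> joint_strategies k G"
  shows "\<exists>\<rho>. satisficing_reachable \<sigma> \<rho> \<and> unsatisfied \<rho> = {}"
proof -
  have fin: "finite (unsatisfied \<pi>)" for \<pi>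
    using finite_players by (simp add: unsatisfied_def)
  have "\<exists>\<pi>. satisficing_reachable \<sigma> \<pi> \<and>
      (\<forall>\<rho>. satisficing_reachable \<sigma> \<rho> \<longrightarrow> card (unsatisfied \<rho>) \<le> card (unsatisfied \<pi>))"
  proof (rule ex_has_greatest_nat[of _ _ _ "Suc (card (players G))"])
    show "satisficing_reachable \<sigma> \<sigma>" by (rule satisficing_reachable_refl[OF \<sigma>])
    show "\<forall>\<pi>. satisficing_reachable \<sigma> \<pi> \<longrightarrow> card (unsatisfied \<pi>) < Suc (card (players G))"
      by (auto simp: unsatisfied_def less_Suc_eq_le intro!: card_mono finite_players)
  qed
  then obtain \<pi> where reach: "satisficing_reachable \<sigma> \<pi>"
    and max: "\<And>\<rho>. satisficing_reachable \<sigma> \<rho> \<Longrightarrow> card (unsatisfied \<rho>) \<le> card (unsatisfied \<pi>)"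
    by blast
  have \<pi>: "\<pi> \<in> joint_strategies k G" by (rule satisficing_reachable_joint[OF reach])
  define U where "U = unsatisfied \<pi>"
  have U: "U \<subseteq> players G" "finite U" using fin by (auto simp: U_def unsatisfied_def)
  \<comment> \<open>The form in which maximality is used: a reachable strategy that keeps all of
    \<open>U\<close> unsatisfied cannot add anyone.\<close>
  have maxU: "unsatisfied \<rho> = U" if "satisficing_reachable \<sigma> \<rho>" "U \<subseteq> unsatisfied \<rho>" for \<rho>
    using card_seteq[OF fin that(2)] max[OF that(1)] by (simp add: U_def)

  \<comment> \<open>Mixing in a little uniform play makes the players of \<open>U\<close> fully
    mixed, while all others stay put.\<close>
  define \<upsilon> where "\<upsilon> = (\<lambda>i\<in>players G. if i \<in> U then \<lambda>z\<in>nodes. pmf_of_set (actions G i) else \<pi> i)"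
  have \<upsilon>: "\<upsilon> \<in> joint_strategies k G"
  proof (rule joint_strategiesI)
    show "\<upsilon> \<in> extensional (players G)" by (simp add: \<upsilon>_def)
    show "\<upsilon> i \<in> extensional nodes" if "i \<in> players G" for i
      using that strategy_extensional(2)[OF \<pi> that] by (simp add: \<upsilon>_def)
    show "set_pmf (\<upsilon> i z) \<subseteq> actions G i" if "i \<in> players G" "z \<in> nodes" for i z
      using that set_strategy[OF \<pi> that] actions_nonempty[OF \<pi> that] finite_actions
      by (auto simp: \<upsilon>_def)
  qed
  have "\<forall>\<^sub>F t in at_right 0. \<forall>i\<in>U. \<not> best_response k G (mixture \<pi> \<upsilon> t) i"
    using U eventually_not_best_response[OF mixture_tendsto[OF \<pi> \<upsilon>]]
    by (intro eventually_ball_finite) (auto simp: U_def unsatisfied_def)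
  then obtain t where t: "t \<in> {0<..<1}" and nbr: "\<And>i. i \<in> U \<Longrightarrow> \<not> best_response k G (mixture \<pi> \<upsilon> t) i"
    using eventually_at_right_0_ex by blast
  define \<mu> where "\<mu> = mixture \<pi> \<upsilon> t"
  have \<mu>: "\<mu> \<in> joint_strategies k G" unfolding \<mu>_def by (rule mixture_joint[OF \<pi> \<upsilon>])
  have "\<mu> i = \<pi> i" if "i \<in> players G - U" for i
    unfolding \<mu>_def using that t by (intro mixture_same[OF \<pi>]) (auto simp: \<upsilon>_def)
  then have reach_\<mu>: "satisficing_reachable \<sigma> \<mu>"
    by (intro satisficing_reachable_step[OF reach \<mu>]) (simp add: U_def)
  have unsat_\<mu>: "unsatisfied \<mu> = U"
    by (rule maxU[OF reach_\<mu>]) (use nbr U in \<open>auto simp: unsatisfied_def \<mu>_def\<close>)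
  have pos: "\<forall>z\<in>nodes. \<forall>a\<in>actions G i. 0 < pmf (\<mu> i z) a" if i: "i \<in> U" for i
  proof (intro ballI)
    fix z a assume z: "z \<in> nodes" and a: "a \<in> actions G i"
    have "i \<in> players G" using i U by blast
    moreover have "0 < pmf (\<upsilon> i z) a"
    proof -
      have "finite (actions G i)" using finite_actions i U by blast
      moreover have "\<upsilon> i z = pmf_of_set (actions G i)" using i z U by (auto simp: \<upsilon>_def)
      moreover have "actions G i \<noteq> {}" using a by blast
      ultimately show ?thesis using a by (intro pmf_positive) simp
    qed
    ultimately show "0 < pmf (\<mu> i z) a"
      unfolding \<mu>_def using t z by (subst pmf_mixture_strategy) (auto intro!: add_nonneg_pos)
  qed

  obtain \<rho> where \<rho>: "\<rho> \<in> joint_strategies k G" and same: "\<And>i. i \<in> players G - U \<Longrightarrow> \<rho> i = \<mu> i"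
    and br: "\<And>i. i \<in> U \<Longrightarrow> best_response k G \<rho> i"
    using exists_partial_equilibrium[OF \<mu> U(1)] by blast
  \<comment> \<open>The unsatisfied players at \<open>\<mu>\<close> are exactly those of
    \<open>U\<close>, so all of them may jump at once.\<close>
  have reach_\<rho>: "satisficing_reachable \<sigma> \<rho>"
    by (rule satisficing_reachable_step[OF reach_\<mu> \<rho>]) (simp add: unsat_\<mu> same)
  have "unsatisfied \<rho> = {}"
  proof (rule ccontr)
    assume "unsatisfied \<rho> \<noteq> {}"
    then obtain j where j: "j \<in> players G" "\<not> best_response k G \<rho> j" by (auto simp: unsatisfied_def)
    then have "j \<notin> U" using br by blast
    have "\<forall>\<^sub>F t in at_right 0. \<not> best_response k G (mixture \<rho> \<mu> t) j"
      by (rule eventually_not_best_response[OF mixture_tendsto[OF \<rho> \<mu>] j])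
    \<comment> \<open>At \<open>\<rho>\<close> the players of \<open>U\<close> are satisfied, so
      openness is of no help for them. Rationality carries their dissatisfaction over from the fully
      mixed far end \<open>\<mu>\<close>.\<close>
    moreover have "\<forall>\<^sub>F t in at_right 0. \<forall>i\<in>U. \<not> best_response k G (mixture \<rho> \<mu> t) i"
    proof (intro eventually_ball_finite U ballI)
      fix i assume i: "i \<in> U"
      then have "i \<in> players G" "\<not> best_response k G \<mu> i"
        using unsat_\<mu> by (auto simp: unsatisfied_def)
      then show "\<forall>\<^sub>F t in at_right 0. \<not> best_response k G (mixture \<rho> \<mu> t) i"
        by (intro eventually_not_best_response_mixture[OF _ \<rho> \<mu> _ pos[OF i]])
    qed
    ultimately have "\<forall>\<^sub>F t in at_right 0. \<not> best_response k G (mixture \<rho> \<mu> t) j \<and>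
        (\<forall>i\<in>U. \<not> best_response k G (mixture \<rho> \<mu> t) i)"
      by (rule eventually_conj)
    then obtain t where t: "t \<in> {0<..<1}" and tj: "\<not> best_response k G (mixture \<rho> \<mu> t) j"
      and tU: "\<And>i. i \<in> U \<Longrightarrow> \<not> best_response k G (mixture \<rho> \<mu> t) i"
      using eventually_at_right_0_ex by blast
    \<comment> \<open>This point is reached from \<open>\<mu>\<close> in place of
      \<open>\<rho>\<close>: from \<open>\<rho>\<close> the players of \<open>U\<close> could not
      move.\<close>
    have "satisficing_reachable \<sigma> (mixture \<rho> \<mu> t)"
    proof (rule satisficing_reachable_step[OF reach_\<mu> mixture_joint[OF \<rho> \<mu>]])
      fix i assume "i \<in> players G - unsatisfied \<mu>"
      then have i: "i \<in> players G" "\<rho> i = \<mu> i" using same unsat_\<mu> by auto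
      have "mixture \<rho> \<mu> t i = \<rho> i" by (rule mixture_same[OF \<rho> i(1)]) (use i t in auto)
      with i show "mixture \<rho> \<mu> t i = \<mu> i" by simp
    qed
    moreover have "U \<subseteq> unsatisfied (mixture \<rho> \<mu> t)" "j \<in> unsatisfied (mixture \<rho> \<mu> t)"
      using tU tj U(1) j(1) by (auto simp: unsatisfied_def)
    ultimately show False using maxU \<open>j \<notin> U\<close> by blast
  qed
  with reach_\<rho> show ?thesis by blast
qed

end

theorem corollary4:
  fixes G :: "('i, 's, 'x) game" and k :: nat
    and \<sigma> :: "'i \<Rightarrow> ('i, 's, 'x) strategy"
  assumes "k > 0"
    and "stochastic_game G"
    and "\<forall>i\<in>players G. finite (actions G i)"
    and "\<sigma> \<in> joint_strategies k G"
  shows "\<exists>T path. satisficing_path k G T path \<and> path 0 = \<sigma> \<and> mixed_equilibrium k G (path T)"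
proof -
  interpret finite_stochastic_game G k
    by (rule finite_stochastic_game.intro) (rule assms)+
  obtain T path where path: "satisficing_path k G T path" "path 0 = \<sigma>" and "unsatisfied (path T) = {}"
    using exists_reachable_equilibrium[OF assms(4)] unfolding satisficing_reachable_def by blast
  then have "mixed_equilibrium k G (path T)"
    unfolding mixed_equilibrium_def satisficing_path_def unsatisfied_def by auto
  with path show ?thesis by blast
qed

end
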